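(* COMMA (the algorithm defined in the context) runs in $\mathcal{O}(k^2\, n \log(nk))$ time on path graphs, where $n$ is the number of nodes of the path and $k$ is the number of measurements.
   Context: **Problem.** Input: a directed path $P$ with $n$ nodes embedded in $\mathbb{R}^2$, whose edges are straight line segments with positive travel time costs, interpolated linearly along each edge; measurements $M_i=(p_i,t_i)$, $i=1,\dots,k$, with position $p_i\in\mathbb{R}^2$ and timestamp $t_i\in\mathbb{R}$; a radius $r\in\mathbb{R}_{\ge0}$. A point of $P$ is identified with its travel time from the start of $P$, and a subpath with the corresponding interval $[a,b]$. Let $D_i$ be the disk of radius $r$ centered at $p_i$; the disks may overlap. A mapping sequence $l_1,\dots,l_k$ of points of $P$ is feasible if $l_i\in D_i$ for all $i$ and, for $i=2,\dots,k$, $l_i$ can be reached from $l_{i-1}$ along $P$ with travel time at most $t_i-t_{i-1}$. COMMA is an algorithm for finding such a sequence. **COMMA** consists of the following phases. If some interval list $I_i$ becomes empty, it aborts and reports that no feasible sequence exists. (1) Interval computation: for each $i$, traverse $P$ edge by edge from start to end, keeping track of the total travel time, and compute the intersections of each edge segment with the boundary of $D_i$ together with their travel times from the start of $P$. Include the start and end of $P$ if contained in $D_i$. In the resulting sorted list, odd entries are interval starts and even entries are interval ends. This gives the sorted list $I_i$ of intervals of $P$ inside $D_i$. (2) Forward sweep: for $i=2,\dots,k$ and each $[a,b]\in I_i$, find by binary search the interval of $I_{i-1}$ with the latest endpoint prior to $a$. Then check the successive intervals of $I_{i-1}$ for intersection with $[a,b]$ until the list ends or an interval starts after $b$. Subdivide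 $[a,b]$ at the starting points of its overlapping intervals. For each subinterval $[a_s,b_s]$ that starts with an overlap with some $[a',b']\in I_{i-1}$, set $b_s=\min(b_s,b'+t_i-t_{i-1})$. If the first subinterval $[a_s,b_s]$ does not start with such an overlap, let $b'$ be the latest endpoint in $I_{i-1}$ prior to $a_s$; delete the subinterval if no such $b'$ exists, otherwise set $b_s=\min(b_s,b'+t_i-t_{i-1})$. Delete empty intervals and merge overlapping intervals of $I_i$. (3) Backward sweep: analogously for $i=k-1,\dots,1$, with the direction reversed. In the non-overlapping case, for $[a,b]\in I_i$ let $a'$ be the earliest starting point of an interval of $I_{i+1}$ after $b$; delete $[a,b]$ if none exists, otherwise set $a=\max(a,a'-t_{i+1}+t_i)$, and delete the interval if it becomes empty. (4) Extraction: let $l_1$ be the endpoint of the last interval of $I_1$. For $i=2,\dots,k$, find by binary search the last $[a,b]\in I_i$ with $a\le l_{i-1}+t_i-t_{i-1}$ and set $l_i=\min(l_{i-1}+t_i-t_{i-1},b)$. *)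

theory Defs
  imports Complex_Main "HOL-Library.Monad_Syntax"
begin

section \<open>Cost model\<close>

text \<open>
  Algorithms are written in a step-counting monad, for a real RAM with unit cost. Everything that is
  computed goes through \<open>tick\<close>, whose argument is always a single elementary operation on numbers,
  truth values or references: one arithmetic operation (including \<open>sqrt\<close>, \<open>min\<close>, \<open>max\<close>), one
  comparison, one allocation of a list cell, one array access. Only sequencing, branching on an
  already computed value, pattern matching (including \<open>tl\<close> of a nonempty list), forming tuples and
  optional values of computed values and passing references are free. Every call of a recursive function
  performs at least one \<open>tick\<close>.
\<close>

datatype 'a timed = Timed (result: 'a) (steps: nat)

definition bind_timed :: "'a timed \<Rightarrow> ('a \<Rightarrow> 'b timed) \<Rightarrow> 'b timed" where
  "bind_timed m f = Timed (result (f (result m))) (steps m + steps (f (result m)))"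


adhoc_overloading Monad_Syntax.bind \<rightleftharpoons> bind_timed

definition return :: "'a \<Rightarrow> 'a timed" where
  "return x = Timed x 0"

definition tick :: "'a \<Rightarrow> 'a timed" where
  "tick x = Timed x 1"

lemma result_tick [simp]: "result (tick x) = x"
  by (simp add: tick_def)

lemma bind_timed_cong [fundef_cong]:
  assumes "m = m'" and "\<And>x. x = result m' \<Longrightarrow> f x = f' x"
  shows "bind_timed m f = bind_timed m' f'"
  using assms by (simp add: bind_timed_def)

text \<open>
  Lists serve as linked lists or stacks: only their first cell is accessed or added. Random access
  needs an array, and turning a list into an array takes time linear in its length.
\<close>

datatype 'a arr = Arr (elems: "'a list")

definition alen :: "'a arr \<Rightarrow> nat timed" where
  "alen A = tick (length (elems A))"

definition aget :: "'a arr \<Rightarrow> nat \<Rightarrow> 'a timed" where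
  "aget A j = tick (elems A ! j)"

definition to_array :: "'a list \<Rightarrow> 'a arr timed" where
  "to_array xs = Timed (Arr xs) (length xs + 1)"

fun rev_onto :: "'a list \<Rightarrow> 'a list \<Rightarrow> 'a list timed" where
  "rev_onto [] ys = tick ys"
| "rev_onto (x # xs) ys = do { zs \<leftarrow> tick (x # ys); rev_onto xs zs }"

text \<open>
  Least \<open>j \<in> {lo..<hi}\<close> satisfying the monotone test \<open>P\<close>, or \<open>hi\<close> if there is none. The
  evaluations of \<open>P\<close> are charged.
\<close>

function bsearch :: "(nat \<Rightarrow> bool timed) \<Rightarrow> nat \<Rightarrow> nat \<Rightarrow> nat timed" where
  "bsearch P lo hi = do {
     more \<leftarrow> tick (lo < hi);
     if more then do {
       s \<leftarrow> tick (lo + hi);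
       mid \<leftarrow> tick (s div 2);
       found \<leftarrow> P mid;
       if found then bsearch P lo mid
       else do { lo' \<leftarrow> tick (mid + 1); bsearch P lo' hi }
     } else return lo
   }"
  by pat_completeness auto
termination
  by (relation "measure (\<lambda>(P, lo, hi). hi - lo)") auto

declare bsearch.simps [simp del]


section \<open>Input\<close>

type_synonym point = "real \<times> real"
type_synonym interval = "real \<times> real"  \<comment> \<open>\<open>(a, b)\<close> is the closed interval \<open>[a, b]\<close> of travel times\<close>
type_synonym measurement = "point \<times> real"

text \<open>\<open>ps\<close> lists the nodes in path order; \<open>cs ! j\<close> is the cost of the edge from \<open>ps ! j\<close> to \<open>ps ! Suc j\<close>.\<close>

definition embedded_path :: "point list \<Rightarrow> real list \<Rightarrow> bool" where
  "embedded_path ps cs \<longleftrightarrow> length ps = length cs + 1 \<and> (\<forall>c \<in> set cs. 0 < c)"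


section \<open>Phase 1: interval computation\<close>

fun in_disk :: "real \<Rightarrow> point \<Rightarrow> point \<Rightarrow> bool timed" where
  "in_disk r (px, py) (ux, uy) = do {
     ex \<leftarrow> tick (ux - px); ey \<leftarrow> tick (uy - py);
     exx \<leftarrow> tick (ex * ex); eyy \<leftarrow> tick (ey * ey); ee \<leftarrow> tick (exx + eyy);
     rr \<leftarrow> tick (r * r);
     tick (ee \<le> rr)
   }"

text \<open>
  The parameters \<open>\<lambda> \<in> [0, 1]\<close> for which \<open>u + \<lambda> (v - u)\<close> lies in the closed disk of radius \<open>r\<close> around
  \<open>p\<close>. With \<open>d = v - u\<close> and \<open>e = u - p\<close> the boundary is met at the roots of
  \<open>|d|\<^sup>2 \<lambda>\<^sup>2 + 2 (d \<bullet> e) \<lambda> + (|e|\<^sup>2 - r\<^sup>2)\<close>; a tangent point counts as a double root.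
\<close>

fun clip :: "real \<Rightarrow> point \<Rightarrow> point \<Rightarrow> point \<Rightarrow> (real \<times> real) option timed" where
  "clip r (px, py) (ux, uy) (vx, vy) = do {
     dx \<leftarrow> tick (vx - ux); dy \<leftarrow> tick (vy - uy);
     ex \<leftarrow> tick (ux - px); ey \<leftarrow> tick (uy - py);
     dxx \<leftarrow> tick (dx * dx); dyy \<leftarrow> tick (dy * dy); a \<leftarrow> tick (dxx + dyy);
     dex \<leftarrow> tick (dx * ex); dey \<leftarrow> tick (dy * ey); h \<leftarrow> tick (dex + dey);
     exx \<leftarrow> tick (ex * ex); eyy \<leftarrow> tick (ey * ey); ee \<leftarrow> tick (exx + eyy);
     rr \<leftarrow> tick (r * r); c \<leftarrow> tick (ee - rr);
     degenerate \<leftarrow> tick (a = 0);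
     if degenerate then do {
       inside \<leftarrow> tick (c \<le> 0);
       return (if inside then Some (0, 1) else None)
     } else do {
       hh \<leftarrow> tick (h * h); ac \<leftarrow> tick (a * c); disc \<leftarrow> tick (hh - ac);
       missed \<leftarrow> tick (disc < 0);
       if missed then return None
       else do {
         s \<leftarrow> tick (sqrt disc);
         g \<leftarrow> tick (- h);
         n1 \<leftarrow> tick (g - s); l1 \<leftarrow> tick (n1 / a); lo \<leftarrow> tick (max 0 l1);
         n2 \<leftarrow> tick (g + s); l2 \<leftarrow> tick (n2 / a); hi \<leftarrow> tick (min 1 l2);
         nonempty \<leftarrow> tick (lo \<le> hi);
         return (if nonempty then Some (lo, hi) else None)
       }
     }
   }"

text \<open>
  \<open>ev\<close> is the list of travel times of boundary points found so far, latest first; its length is even.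
  \<open>T\<close> is the travel time to the start of the current edge, \<open>c\<close> the cost of the edge. If the part of
  the edge inside the disk begins where the previous one ended, the path does not leave the disk at
  the common node, so that node does not stay in the list. In particular the end of the path is in
  the final list iff it lies in the disk.
\<close>

fun add_events :: "real \<Rightarrow> real \<Rightarrow> (real \<times> real) option \<Rightarrow> real list \<Rightarrow> real list timed" where
  "add_events T c None ev = tick ev"
| "add_events T c (Some (lo, hi)) ev = do {
     dx \<leftarrow> tick (lo * c); x \<leftarrow> tick (T + dx);
     dy \<leftarrow> tick (hi * c); y \<leftarrow> tick (T + dy);
     joined \<leftarrow> (case ev of [] \<Rightarrow> tick False | z # zs \<Rightarrow> tick (z = x));
     if joined then tick (y # tl ev)
     else do { ev' \<leftarrow> tick (x # ev); tick (y # ev') }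
   }"

fun traverse :: "real \<Rightarrow> point \<Rightarrow> real \<Rightarrow> point \<Rightarrow> point list \<Rightarrow> real list \<Rightarrow> real list \<Rightarrow> real list timed" where
  "traverse r p T u (v # vs) (c # cs) ev = do {
     q \<leftarrow> clip r p u v;
     ev' \<leftarrow> add_events T c q ev;
     T' \<leftarrow> tick (T + c);
     traverse r p T' v vs cs ev'
   }"
| "traverse r p T u vs cs ev = tick ev"

text \<open>Odd entries are interval starts, even entries are interval ends; \<open>ev\<close> lists the last entry first.\<close>

fun pair_up :: "real list \<Rightarrow> interval list \<Rightarrow> interval list timed" where
  "pair_up (e # s # ev) Is = do { Is' \<leftarrow> tick ((s, e) # Is); pair_up ev Is' }"
| "pair_up ev Is = tick Is"

fun path_intervals :: "real \<Rightarrow> point \<Rightarrow> point list \<Rightarrow> real list \<Rightarrow> interval arr timed" where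
  "path_intervals r p [] cs = to_array []"
| "path_intervals r p (u # us) cs = do {
     inside \<leftarrow> in_disk r p u;
     ev \<leftarrow> (if inside then do { ev' \<leftarrow> tick [0]; tick (0 # ev') } else tick []);
     ev' \<leftarrow> traverse r p 0 u us cs ev;
     Is \<leftarrow> pair_up ev' [];
     to_array Is
   }"

definition is_empty :: "'a arr \<Rightarrow> bool timed" where
  "is_empty A = do { l \<leftarrow> alen A; tick (l = 0) }"

text \<open>From here on each interval array is kept with the timestamp of its measurement.\<close>

fun all_intervals ::
  "real \<Rightarrow> point list \<Rightarrow> real list \<Rightarrow> measurement list \<Rightarrow> (real \<times> interval arr) list option timed" where
  "all_intervals r ps cs [] = tick (Some [])"
| "all_intervals r ps cs ((p, t) # ms) = do {
     I \<leftarrow> path_intervals r p ps cs;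
     none \<leftarrow> is_empty I;
     if none then return None
     else do {
       rest \<leftarrow> all_intervals r ps cs ms;
       (case rest of
          None \<Rightarrow> return None
        | Some Is \<Rightarrow> do { Is' \<leftarrow> tick ((t, I) # Is); return (Some Is') })
     }
   }"


section \<open>Phase 2: forward sweep\<close>

text \<open>
  Below, \<open>prev\<close> is \<open>I\<^sub>i\<^sub>-\<^sub>1\<close>, \<open>[a, b]\<close> is an interval of \<open>I\<^sub>i\<close> and \<open>\<delta> = t\<^sub>i - t\<^sub>i\<^sub>-\<^sub>1\<close>. A subinterval \<open>[s, e]\<close>
  comes with \<open>lm\<close>, which is the end \<open>b'\<close> of the interval of \<open>prev\<close> that restricts it, if any.
\<close>

fun put_fwd :: "real \<Rightarrow> real \<Rightarrow> real \<Rightarrow> real option \<Rightarrow> interval list \<Rightarrow> interval list timed" where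
  "put_fwd \<delta> s e None out = tick out"
| "put_fwd \<delta> s e (Some b') out = do {
     x \<leftarrow> tick (b' + \<delta>);
     e' \<leftarrow> tick (min e x);
     tick ((s, e') # out)
   }"

text \<open>\<open>[s, b]\<close> is the part of \<open>[a, b]\<close> still to be subdivided, \<open>q\<close> the next interval of \<open>prev\<close> to check.\<close>

function scan_fwd :: "real \<Rightarrow> interval arr \<Rightarrow> real \<Rightarrow> nat \<Rightarrow> real \<Rightarrow> real option \<Rightarrow> interval list
    \<Rightarrow> interval list timed" where
  "scan_fwd \<delta> prev b q s lm out = do {
     len \<leftarrow> alen prev;
     more \<leftarrow> tick (q < len);
     if more then do {
       (a', b') \<leftarrow> aget prev q;
       overlap \<leftarrow> tick (a' \<le> b);
       if overlap then do {
         out' \<leftarrow> put_fwd \<delta> s a' lm out;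
         q' \<leftarrow> tick (q + 1);
         scan_fwd \<delta> prev b q' a' (Some b') out'
       } else put_fwd \<delta> s b lm out
     } else put_fwd \<delta> s b lm out
   }"
  by pat_completeness auto
termination
  by (relation "measure (\<lambda>(\<delta>, prev, b, q, s, lm, out). length (elems prev) - q)")
     (auto simp: alen_def)

declare scan_fwd.simps [simp del]

definition split_fwd :: "real \<Rightarrow> interval arr \<Rightarrow> interval \<Rightarrow> interval list \<Rightarrow> interval list timed" where
  "split_fwd \<delta> prev = (\<lambda>(a, b) out. do {
     len \<leftarrow> alen prev;
     m \<leftarrow> bsearch (\<lambda>j. do { (a', b') \<leftarrow> aget prev j; tick (a \<le> b') }) 0 len;
     more \<leftarrow> tick (m < len);
     starts_in \<leftarrow> (if more then do { (a', b') \<leftarrow> aget prev m; tick (a' \<le> a) } else tick False);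
     if starts_in then do {
       (a', b') \<leftarrow> aget prev m;
       q \<leftarrow> tick (m + 1);
       scan_fwd \<delta> prev b q a (Some b') out
     } else do {
       earlier \<leftarrow> tick (0 < m);
       if earlier then do {
         j \<leftarrow> tick (m - 1);
         (a', b') \<leftarrow> aget prev j;
         scan_fwd \<delta> prev b m a (Some b') out
       } else scan_fwd \<delta> prev b m a None out
     }
   })"

text \<open>All subintervals, last one first; \<open>j\<close> is the next interval of \<open>cur\<close>.\<close>

function subdivide_fwd :: "real \<Rightarrow> interval arr \<Rightarrow> interval arr \<Rightarrow> nat \<Rightarrow> interval list
    \<Rightarrow> interval list timed" where
  "subdivide_fwd \<delta> prev cur j out = do {
     len \<leftarrow> alen cur;
     more \<leftarrow> tick (j < len);
     if more then do {
       I \<leftarrow> aget cur j;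
       out' \<leftarrow> split_fwd \<delta> prev I out;
       j' \<leftarrow> tick (j + 1);
       subdivide_fwd \<delta> prev cur j' out'
     } else return out
   }"
  by pat_completeness auto
termination
  by (relation "measure (\<lambda>(\<delta>, prev, cur, j, out). length (elems cur) - j)")
     (auto simp: alen_def)

declare subdivide_fwd.simps [simp del]

text \<open>
  Deletes empty intervals and merges overlapping ones, for a list that is monotone in either direction;
  the result is in the opposite order. Closed intervals sharing an endpoint overlap.
\<close>

fun clean_up :: "interval list \<Rightarrow> interval list \<Rightarrow> interval list timed" where
  "clean_up [] out = tick out"
| "clean_up ((s, e) # subs) out = do {
     nonempty \<leftarrow> tick (s \<le> e);
     if nonempty then
       (case out of
          [] \<Rightarrow> do { out' \<leftarrow> tick [(s, e)]; clean_up subs out' }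
        | (x, y) # rest \<Rightarrow> do {
            c1 \<leftarrow> tick (s \<le> y);
            c2 \<leftarrow> tick (x \<le> e);
            overlap \<leftarrow> tick (c1 \<and> c2);
            if overlap then do {
              s' \<leftarrow> tick (min s x);
              e' \<leftarrow> tick (max e y);
              out' \<leftarrow> tick ((s', e') # rest);
              clean_up subs out'
            } else do { out' \<leftarrow> tick ((s, e) # out); clean_up subs out' }
          })
     else clean_up subs out
   }"

definition step_fwd :: "real \<Rightarrow> interval arr \<Rightarrow> interval arr \<Rightarrow> interval arr timed" where
  "step_fwd \<delta> prev cur = do {
     subs \<leftarrow> subdivide_fwd \<delta> prev cur 0 [];
     Is \<leftarrow> clean_up subs [];
     to_array Is
   }"

text \<open>\<open>(t, prev)\<close> is the entry just completed, \<open>acc\<close> the stack of all completed entries, latest first.\<close>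

fun forward_sweep :: "real \<Rightarrow> interval arr \<Rightarrow> (real \<times> interval arr) list \<Rightarrow> (real \<times> interval arr) list
    \<Rightarrow> (real \<times> interval arr) list option timed" where
  "forward_sweep t prev [] acc = tick (Some acc)"
| "forward_sweep t prev ((t', cur) # rest) acc = do {
     \<delta> \<leftarrow> tick (t' - t);
     I \<leftarrow> step_fwd \<delta> prev cur;
     none \<leftarrow> is_empty I;
     if none then return None
     else do { acc' \<leftarrow> tick ((t', I) # acc); forward_sweep t' I rest acc' }
   }"


section \<open>Phase 3: backward sweep\<close>

text \<open>
  The mirror image of phase 2: \<open>nxt\<close> is \<open>I\<^sub>i\<^sub>+\<^sub>1\<close> and \<open>\<delta> = t\<^sub>i\<^sub>+\<^sub>1 - t\<^sub>i\<close>, intervals are subdivided at the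
  ends of the overlapping intervals of \<open>nxt\<close>, and the starts of the subintervals are restricted.
\<close>

fun put_bwd :: "real \<Rightarrow> real \<Rightarrow> real \<Rightarrow> real option \<Rightarrow> interval list \<Rightarrow> interval list timed" where
  "put_bwd \<delta> s e None out = tick out"
| "put_bwd \<delta> s e (Some a') out = do {
     x \<leftarrow> tick (a' - \<delta>);
     s' \<leftarrow> tick (max s x);
     tick ((s', e) # out)
   }"

text \<open>\<open>[a, e]\<close> is the part of \<open>[a, b]\<close> still to be subdivided; the intervals of \<open>nxt\<close> with index below \<open>q\<close>
  are still to be checked, in descending order.\<close>

fun scan_bwd :: "real \<Rightarrow> interval arr \<Rightarrow> real \<Rightarrow> nat \<Rightarrow> real \<Rightarrow> real option \<Rightarrow> interval list
    \<Rightarrow> interval list timed" where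
  "scan_bwd \<delta> nxt a q e lm out = do {
     more \<leftarrow> tick (0 < q);
     if more then do {
       q' \<leftarrow> tick (q - 1);
       (a', b') \<leftarrow> aget nxt q';
       overlap \<leftarrow> tick (a \<le> b');
       if overlap then do {
         out' \<leftarrow> put_bwd \<delta> b' e lm out;
         scan_bwd \<delta> nxt a q' b' (Some a') out'
       } else put_bwd \<delta> a e lm out
     } else put_bwd \<delta> a e lm out
   }"

declare scan_bwd.simps [simp del]

definition split_bwd :: "real \<Rightarrow> interval arr \<Rightarrow> interval \<Rightarrow> interval list \<Rightarrow> interval list timed" where
  "split_bwd \<delta> nxt = (\<lambda>(a, b) out. do {
     len \<leftarrow> alen nxt;
     m \<leftarrow> bsearch (\<lambda>j. do { (a', b') \<leftarrow> aget nxt j; tick (b < a') }) 0 len;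
     more \<leftarrow> tick (0 < m);
     ends_in \<leftarrow> (if more then do { j \<leftarrow> tick (m - 1); (a', b') \<leftarrow> aget nxt j; tick (b \<le> b') }
                 else tick False);
     if ends_in then do {
       q \<leftarrow> tick (m - 1);
       (a', b') \<leftarrow> aget nxt q;
       scan_bwd \<delta> nxt a q b (Some a') out
     } else do {
       later \<leftarrow> tick (m < len);
       if later then do {
         (a', b') \<leftarrow> aget nxt m;
         scan_bwd \<delta> nxt a m b (Some a') out
       } else scan_bwd \<delta> nxt a m b None out
     }
   })"

fun subdivide_bwd :: "real \<Rightarrow> interval arr \<Rightarrow> interval arr \<Rightarrow> nat \<Rightarrow> interval list
    \<Rightarrow> interval list timed" where
  "subdivide_bwd \<delta> nxt cur j out = do {
     more \<leftarrow> tick (0 < j);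
     if more then do {
       j' \<leftarrow> tick (j - 1);
       I \<leftarrow> aget cur j';
       out' \<leftarrow> split_bwd \<delta> nxt I out;
       subdivide_bwd \<delta> nxt cur j' out'
     } else return out
   }"

declare subdivide_bwd.simps [simp del]

definition step_bwd :: "real \<Rightarrow> interval arr \<Rightarrow> interval arr \<Rightarrow> interval arr timed" where
  "step_bwd \<delta> nxt cur = do {
     len \<leftarrow> alen cur;
     subs \<leftarrow> subdivide_bwd \<delta> nxt cur len [];
     Is \<leftarrow> clean_up subs [];
     Is' \<leftarrow> rev_onto Is [];
     to_array Is'
   }"

fun backward_sweep :: "real \<Rightarrow> interval arr \<Rightarrow> (real \<times> interval arr) list \<Rightarrow> (real \<times> interval arr) list
    \<Rightarrow> (real \<times> interval arr) list option timed" where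
  "backward_sweep t nxt [] acc = tick (Some acc)"
| "backward_sweep t nxt ((t', cur) # rest) acc = do {
     \<delta> \<leftarrow> tick (t - t');
     I \<leftarrow> step_bwd \<delta> nxt cur;
     none \<leftarrow> is_empty I;
     if none then return None
     else do { acc' \<leftarrow> tick ((t', I) # acc); backward_sweep t' I rest acc' }
   }"


section \<open>Phase 4: extraction\<close>

text \<open>
  \<open>l\<close> is \<open>l\<^sub>i\<^sub>-\<^sub>1\<close> and \<open>t\<close> is \<open>t\<^sub>i\<^sub>-\<^sub>1\<close>; \<open>acc\<close> holds the points found so far, latest first. After the backward
  sweep the interval looked for always exists; reporting failure otherwise only makes the function total.
\<close>

fun extraction :: "real \<Rightarrow> real \<Rightarrow> (real \<times> interval arr) list \<Rightarrow> real list \<Rightarrow> real list option timed" where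
  "extraction t l [] acc = do { ls \<leftarrow> rev_onto acc []; return (Some ls) }"
| "extraction t l ((t', I) # rest) acc = do {
     \<delta> \<leftarrow> tick (t' - t);
     x \<leftarrow> tick (l + \<delta>);
     len \<leftarrow> alen I;
     m \<leftarrow> bsearch (\<lambda>j. do { (a, b) \<leftarrow> aget I j; tick (x < a) }) 0 len;
     none \<leftarrow> tick (m = 0);
     if none then return None
     else do {
       j \<leftarrow> tick (m - 1);
       (a, b) \<leftarrow> aget I j;
       l' \<leftarrow> tick (min x b);
       acc' \<leftarrow> tick (l' # acc);
       extraction t' l' rest acc'
     }
   }"

definition start_extraction :: "(real \<times> interval arr) list \<Rightarrow> real list option timed" where
  "start_extraction Is = (case Is of
     [] \<Rightarrow> tick (Some [])
   | (t, I) # rest \<Rightarrow> do {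
       len \<leftarrow> alen I;
       j \<leftarrow> tick (len - 1);
       (a, b) \<leftarrow> aget I j;
       acc \<leftarrow> tick [b];
       extraction t b rest acc
     })"


section \<open>The algorithm\<close>

text \<open>
  The result is \<open>None\<close> if no feasible mapping sequence exists, and \<open>Some [l\<^sub>1, \<dots>, l\<^sub>k]\<close> otherwise, the
  points of the path being given by their travel times.
\<close>

definition start_forward ::
  "(real \<times> interval arr) list \<Rightarrow> (real \<times> interval arr) list option timed" where
  "start_forward Is = (case Is of
     [] \<Rightarrow> tick (Some [])
   | (t, I) # rest \<Rightarrow> do { acc \<leftarrow> tick [(t, I)]; forward_sweep t I rest acc })"

definition start_backward ::
  "(real \<times> interval arr) list \<Rightarrow> (real \<times> interval arr) list option timed" where
  "start_backward Is = (case Is of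
     [] \<Rightarrow> tick (Some [])
   | (t, I) # rest \<Rightarrow> do { acc \<leftarrow> tick [(t, I)]; backward_sweep t I rest acc })"

definition if_some :: "'a option timed \<Rightarrow> ('a \<Rightarrow> 'b option timed) \<Rightarrow> 'b option timed" where
  "if_some m f = do { x \<leftarrow> m; (case x of None \<Rightarrow> return None | Some y \<Rightarrow> f y) }"

definition comma :: "real \<Rightarrow> point list \<Rightarrow> real list \<Rightarrow> measurement list \<Rightarrow> real list option timed" where
  "comma r ps cs ms =
     if_some (all_intervals r ps cs ms) (\<lambda>Is.
     if_some (start_forward Is) (\<lambda>Fs.
     if_some (start_backward Fs) start_extraction))"

definition comma_time :: "real \<Rightarrow> point list \<Rightarrow> real list \<Rightarrow> measurement list \<Rightarrow> nat" where
  "comma_time r ps cs ms = steps (comma r ps cs ms)"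

end

theory Submission
  imports Defs
begin

text \<open>
  Let \<open>F\<^sub>i\<close> and \<open>B\<^sub>i\<close> be the interval lists after the forward and the backward sweep. One sweep step costs
  \<open>O(m log m)\<close>, where \<open>m\<close> is the total length of the two lists involved, since the pieces it
  produces have distinct starting points, each being the start of an interval of one of the two lists.
  Hence \<open>|F\<^sub>i| \<le> i n\<close>, and it remains to see that \<open>|B\<^sub>i| = O(k n)\<close>; the same estimate applied to \<open>B\<^sub>i\<close> only gives \<open>O(k\<^sup>2 n)\<close>.

  As sets, \<open>F\<^sub>i\<^sub>+\<^sub>1 = I\<^sub>i\<^sub>+\<^sub>1 \<inter> \<Union>[a, b + \<delta>]\<close> over the intervals \<open>[a, b]\<close> of \<open>F\<^sub>i\<close>, and
  \<open>B\<^sub>i = F\<^sub>i \<inter> \<Union>[a - \<delta>, b]\<close> over those of \<open>B\<^sub>i\<^sub>+\<^sub>1\<close>; this also holds if \<open>\<delta> < 0\<close>, as timestamps are not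
  assumed to increase. Count gaps instead of intervals. Let \<open>u\<^sub>i\<close> be the number of gaps of \<open>B\<^sub>i\<close> that
  contain no gap of \<open>F\<^sub>i\<close>. Such a gap comes from a gap \<open>(g', h')\<close> of \<open>B\<^sub>i\<^sub>+\<^sub>1\<close>, as \<open>(g', h' - \<delta>)\<close>. If \<open>(g', h')\<close>
  contained the trace \<open>(g + \<delta>, h)\<close> of a gap \<open>(g, h)\<close> of \<open>F\<^sub>i\<close>, then \<open>(g', h' - \<delta>)\<close> would meet \<open>(g, h)\<close>,
  and the gap of \<open>B\<^sub>i\<close> would contain \<open>(g, h)\<close>. So \<open>(g', h')\<close> either contains no gap of \<open>F\<^sub>i\<^sub>+\<^sub>1\<close> or
  contains a gap of \<open>I\<^sub>i\<^sub>+\<^sub>1\<close>, whence \<open>u\<^sub>i \<le> u\<^sub>i\<^sub>+\<^sub>1 + n\<close> and \<open>|B\<^sub>i| \<le> |F\<^sub>i| + k n + 1\<close>.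
\<close>

section \<open>The step-counting monad\<close>

lemma result_bind [simp]: "result (bind_timed m f) = result (f (result m))"
  and steps_bind [simp]: "steps (bind_timed m f) = steps m + steps (f (result m))"
  by (simp_all add: bind_timed_def)

lemma steps_tick [simp]: "steps (tick x) = 1"
  by (simp add: tick_def)

lemma result_return [simp]: "result (return x) = x"
  and steps_return [simp]: "steps (return x) = 0"
  by (simp_all add: return_def)

lemma result_alen [simp]: "result (alen A) = length (elems A)"
  and steps_alen [simp]: "steps (alen A) = 1"
  by (simp_all add: alen_def)

lemma result_aget [simp]: "result (aget A j) = elems A ! j"
  and steps_aget [simp]: "steps (aget A j) = 1"
  by (simp_all add: aget_def)

lemma result_to_array [simp]: "result (to_array xs) = Arr xs"
  and steps_to_array [simp]: "steps (to_array xs) = length xs + 1"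
  by (simp_all add: to_array_def)

lemma result_is_empty [simp]: "result (is_empty A) = (elems A = [])"
  and steps_is_empty [simp]: "steps (is_empty A) = 2"
  by (simp_all add: is_empty_def)

lemma result_rev_onto [simp]: "result (rev_onto xs ys) = rev xs @ ys"
  by (induction xs ys rule: rev_onto.induct) simp_all

lemma steps_rev_onto [simp]: "steps (rev_onto xs ys) = length xs + 1"
  by (induction xs ys rule: rev_onto.induct) simp_all

section \<open>Binary search: the position found and its cost\<close>

lemma result_bsearch:
  assumes "lo \<le> hi"
  shows "lo \<le> result (bsearch P lo hi) \<and> result (bsearch P lo hi) \<le> hi
    \<and> (result (bsearch P lo hi) < hi \<longrightarrow> result (P (result (bsearch P lo hi))))
    \<and> (lo < result (bsearch P lo hi) \<longrightarrow> \<not> result (P (result (bsearch P lo hi) - 1)))"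
  using assms
\<comment> \<open>Invariant: \<open>hi\<close> only moves to a position where \<open>P\<close>
  holds, and \<open>lo\<close> only moves to just past one where it fails. Callers extend these two
  values to the whole array by \<open>sep\<close>.\<close>
proof (induction "hi - lo" arbitrary: lo hi rule: less_induct)
  case less
  show ?case
  proof (cases "lo < hi")
    case True
    define mid where "mid = (lo + hi) div 2"
    have mid: "lo \<le> mid" "mid < hi"
      using True by (auto simp: mid_def)
    show ?thesis
    proof (cases "result (P mid)")
      case found: True
      have "result (bsearch P lo hi) = result (bsearch P lo mid)"
        using True found by (subst bsearch.simps) (simp add: mid_def)
      moreover have "mid - lo < hi - lo"
        using mid by simp
      ultimately show ?thesis
        using less.hyps[of mid lo] mid found by (metis less_le_trans less_or_eq_imp_le order_le_less)
    next
      case not_found: False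
      have "result (bsearch P lo hi) = result (bsearch P (Suc mid) hi)"
        using True not_found by (subst bsearch.simps) (simp add: mid_def)
      moreover have "hi - Suc mid < hi - lo" "Suc mid \<le> hi"
        using mid by auto
      ultimately show ?thesis
        using less.hyps[of hi "Suc mid"] mid not_found
        by (metis Suc_leD diff_Suc_1 le_trans le_neq_implies_less)
    qed
  next
    case False
    then show ?thesis
      using less.prems bsearch.simps[of P lo hi] by simp
  qed
qed

text \<open>A round costs at most four ticks besides the test and halves the range; the last tick is
  the comparison that ends the search.\<close>

lemma steps_bsearch:
  assumes P: "\<And>j. steps (P j) \<le> c" and "hi - lo < 2 ^ t"
  shows "steps (bsearch P lo hi) \<le> (c + 4) * t + 1"
  using assms(2)
proof (induction t arbitrary: lo hi)
  case 0
  then show ?case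
    by (subst bsearch.simps) simp
next
  case (Suc t)
  define mid where "mid = (lo + hi) div 2"
  show ?case
  proof (cases "lo < hi")
    case True
    then have "mid - lo < 2 ^ t" "hi - Suc mid < 2 ^ t"
      using Suc.prems by (auto simp: mid_def)
    then have "steps (bsearch P lo mid) \<le> (c + 4) * t + 1"
      "steps (bsearch P (Suc mid) hi) \<le> (c + 4) * t + 1"
      using Suc.IH by blast+
    then show ?thesis
      using True P[of mid] by (subst bsearch.simps) (auto simp: mid_def[symmetric])
  next
    case False
    then show ?thesis
      by (subst bsearch.simps) simp
  qed
qed

section \<open>Separated interval lists\<close>

text \<open>Strict between intervals, because closed intervals with a common endpoint are merged, so
  that gaps are never degenerate; weak within an interval, because a tangent disk yields a single
  point.\<close>

definition sep :: "interval list \<Rightarrow> bool" where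
  "sep L \<longleftrightarrow> sorted_wrt (\<lambda>I J. snd I < fst J) L \<and> (\<forall>I \<in> set L. fst I \<le> snd I)"

lemma sep_Nil [simp]: "sep []"
  by (simp add: sep_def)

lemma sep_Cons: "sep ((a, b) # L) \<longleftrightarrow> a \<le> b \<and> (\<forall>(a', b') \<in> set L. b < a') \<and> sep L"
  by (auto simp: sep_def)

text \<open>The points reachable from \<open>L\<close> within time \<delta>; for \<delta> = 0 the
  point set of \<open>L\<close>. If \<delta> is negative, an interval can contribute
  nothing.\<close>

definition cov :: "real \<Rightarrow> interval list \<Rightarrow> real set" where
  "cov \<delta> L = (\<Union>(a, b) \<in> set L. {a..b + \<delta>})"

lemma cov_Nil [simp]: "cov \<delta> [] = {}"
  and cov_Cons: "cov \<delta> ((a, b) # L) = {a..b + \<delta>} \<union> cov \<delta> L"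
  and cov_append [simp]: "cov \<delta> (L @ L') = cov \<delta> L \<union> cov \<delta> L'"
  by (auto simp: cov_def)

lemma cov_ge: "x \<in> cov \<delta> L \<Longrightarrow> (\<And>a b. (a, b) \<in> set L \<Longrightarrow> y < a) \<Longrightarrow> y < x"
  unfolding cov_def by fastforce

section \<open>Subdivision along the preceding list: coverage, order and number of the
  pieces\<close>

fun put :: "real \<Rightarrow> real \<Rightarrow> real \<Rightarrow> real option \<Rightarrow> interval list" where
  "put \<delta> s e None = []"
| "put \<delta> s e (Some b') = [(s, min e (b' + \<delta>))]"

text \<open>
  \<open>pieces \<delta> b s lm L\<close> is what \<open>scan_fwd\<close> pushes when \<open>L\<close> holds the intervals of the previous list still
  to be checked. The first test, never passed during a scan, skips the intervals that the algorithm
  skips by binary search, so that \<open>pieces \<delta> b a None L\<close> subdivides \<open>[a, b]\<close> along the whole list.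
\<close>

fun pieces :: "real \<Rightarrow> real \<Rightarrow> real \<Rightarrow> real option \<Rightarrow> interval list \<Rightarrow> interval list" where
  "pieces \<delta> b s lm [] = put \<delta> s b lm"
| "pieces \<delta> b s lm ((a', b') # L) =
     (if a' \<le> s then pieces \<delta> b s (Some b') L
      else if a' \<le> b then pieces \<delta> b a' (Some b') L @ put \<delta> s a' lm
      else put \<delta> s b lm)"

definition subs :: "real \<Rightarrow> interval list \<Rightarrow> interval list \<Rightarrow> interval list" where
  "subs \<delta> L C = concat (rev (map (\<lambda>(a, b). pieces \<delta> b a None L) C))"

lemma subs_Nil [simp]: "subs \<delta> L [] = []"
  and subs_Cons: "subs \<delta> L ((a, b) # C) = subs \<delta> L C @ pieces \<delta> b a None L"
  by (simp_all add: subs_def)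

lemma cov_put: "cov 0 (put \<delta> s e lm) = {s..e} \<inter> (case lm of None \<Rightarrow> {} | Some b' \<Rightarrow> {..b' + \<delta>})"
  by (cases lm) (auto simp: cov_Cons)

text \<open>Among the intervals starting at or before a point, the last one reaches furthest, so a
  single cap \<open>lm\<close> stands for all of them. Caps grow along the list, hence cutting at
  \<open>a'\<close> loses nothing: what the old cap reaches beyond \<open>a'\<close> is also below
  the new one.\<close>

lemma cov_pieces:
  assumes "sep L" "s \<le> b" "\<And>l a' b'. lm = Some l \<Longrightarrow> (a', b') \<in> set L \<Longrightarrow> l < a'"
  shows "cov 0 (pieces \<delta> b s lm L)
    = {s..b} \<inter> (cov \<delta> L \<union> (case lm of None \<Rightarrow> {} | Some b' \<Rightarrow> {..b' + \<delta>}))"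
  using assms
proof (induction \<delta> b s lm L rule: pieces.induct)
  case (1 \<delta> b s lm)
  then show ?case by (simp add: cov_put)
next
  case (2 \<delta> b s lm a' b' L)
  have L: "sep L" "a' \<le> b'" and tail: "\<And>u v. (u, v) \<in> set L \<Longrightarrow> b' < u"
    using "2.prems"(1) by (auto simp: sep_Cons)
  have low: "l \<le> b'" if "lm = Some l" for l
    using "2.prems"(3)[OF that, of a' b'] L(2) by simp
  have tailc: "x \<in> cov \<delta> L \<Longrightarrow> b' < x" for x
    using cov_ge[of x \<delta> L b'] tail by blast
  show ?case
  proof (cases "a' \<le> s")
    case True
    then have "cov 0 (pieces \<delta> b s (Some b') L) = {s..b} \<inter> (cov \<delta> L \<union> {..b' + \<delta>})"
      using "2.IH"(1) L "2.prems"(2) tail by auto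
    then show ?thesis
      using True low by (fastforce simp: cov_Cons split: option.splits)
  next
    case ns: False
    show ?thesis
    proof (cases "a' \<le> b")
      case True
      then have "cov 0 (pieces \<delta> b a' (Some b') L) = {a'..b} \<inter> (cov \<delta> L \<union> {..b' + \<delta>})"
        using "2.IH"(2) L ns tail by auto
      then show ?thesis
        using ns True low L(2) by (fastforce simp: cov_Cons cov_put dest: tailc split: option.splits)
    next
      case False
      then show ?thesis
        using ns L(2) by (fastforce simp: cov_Cons cov_put dest: tailc split: option.splits)
    qed
  qed
qed

lemma put_bounds: "(x, y) \<in> set (put \<delta> s e lm) \<Longrightarrow> x = s \<and> y \<le> e"
  by (cases lm) auto

text \<open>The last conjunct, on where pieces may start, is what \<open>length_subs\<close> counts
  with.\<close>

lemma pieces_bounds: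
  assumes "(x, y) \<in> set (pieces \<delta> b s lm L)" "s \<le> b"
  shows "s \<le> x \<and> x \<le> b \<and> y \<le> b \<and> x \<in> insert s (fst ` set L)"
  using assms
  by (induction \<delta> b s lm L rule: pieces.induct)
     (auto split: if_splits dest!: put_bounds)

text \<open>The order of pieces on the stack, last piece on top. Starts are strictly ordered, which
  makes them distinct; consecutive pieces may touch at a cut point.\<close>

abbreviation later :: "interval \<Rightarrow> interval \<Rightarrow> bool" where
  "later I J \<equiv> fst J < fst I \<and> snd J \<le> fst I"

lemma pieces_later: "s \<le> b \<Longrightarrow> sorted_wrt later (pieces \<delta> b s lm L)"
proof (induction \<delta> b s lm L rule: pieces.induct)
  case (1 \<delta> b s lm)
  then show ?case by (cases lm) auto
next
  case (2 \<delta> b s lm a' b' L)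
  then show ?case
    by (cases lm) (auto simp: sorted_wrt_append dest!: pieces_bounds)
qed

lemma subs_bounds:
  assumes "(x, y) \<in> set (subs \<delta> L C)" "sep C"
  shows "\<exists>(a, b) \<in> set C. a \<le> x \<and> x \<le> b \<and> y \<le> b \<and> x \<in> insert a (fst ` set L)"
proof -
  obtain a b where "(a, b) \<in> set C" "(x, y) \<in> set (pieces \<delta> b a None L)"
    using assms(1) by (auto simp: subs_def)
  moreover from this have "a \<le> b"
    using assms(2) by (auto simp: sep_def)
  ultimately show ?thesis
    using pieces_bounds by blast
qed

lemma subs_later: "sep C \<Longrightarrow> sorted_wrt later (subs \<delta> L C)"
proof (induction C)
  case (Cons I C)
  obtain a b where I: "I = (a, b)" by force
  have C: "a \<le> b" "sep C" "\<And>a' b'. (a', b') \<in> set C \<Longrightarrow> b < a'"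
    using Cons.prems by (auto simp: I sep_Cons)
  have "later J K" if "J \<in> set (subs \<delta> L C)" "K \<in> set (pieces \<delta> b a None L)" for J K
    using subs_bounds[of "fst J" "snd J" \<delta> L C] pieces_bounds[of "fst K" "snd K" \<delta> b a None L]
      that C by fastforce
  then show ?case
    using Cons.IH C pieces_later by (auto simp: I subs_Cons sorted_wrt_append)
qed simp

lemma cov_subs:
  assumes "sep C" "sep L"
  shows "cov 0 (subs \<delta> L C) = cov 0 C \<inter> cov \<delta> L"
  using assms(1)
proof (induction C)
  case (Cons I C)
  obtain a b where I: "I = (a, b)" by force
  show ?case
    using Cons cov_pieces[OF assms(2), of a b None \<delta>]
    by (auto simp: I subs_Cons cov_Cons sep_Cons)
qed simp

text \<open>Counting starts over the whole of \<open>C\<close> at once gives a sum; a bound for each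
  interval of \<open>C\<close> separately would only give a product.\<close>

lemma length_subs:
  assumes "sep C"
  shows "length (subs \<delta> L C) \<le> length C + length L"
proof -
  have "distinct (map fst xs)" if "sorted_wrt later xs" for xs
    using that by (induction xs) auto
  then have "distinct (map fst (subs \<delta> L C))"
    using subs_later[OF assms] by blast
  then have "length (subs \<delta> L C) = card (fst ` set (subs \<delta> L C))"
    by (metis distinct_card length_map set_map)
  also have "\<dots> \<le> card (fst ` set C \<union> fst ` set L)"
    using subs_bounds[OF _ assms] by (intro card_mono) force+
  also have "\<dots> \<le> length C + length L"
    by (metis add_mono card_Un_le card_length le_trans length_map set_map)
  finally show ?thesis .
qed

section \<open>Deletion of empty pieces and merging\<close>

definition clean :: "interval list \<Rightarrow> interval list \<Rightarrow> interval list" where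
  "clean xs out = result (clean_up xs out)"

lemma clean_simps [simp]:
  "clean [] out = out"
  "clean ((s, e) # xs) [] = (if s \<le> e then clean xs [(s, e)] else clean xs [])"
  "clean ((s, e) # xs) ((x, y) # out) =
     (if s \<le> e then if s \<le> y \<and> x \<le> e then clean xs ((min s x, max e y) # out)
        else clean xs ((s, e) # (x, y) # out)
      else clean xs ((x, y) # out))"
  by (simp_all add: clean_def)

lemma steps_clean_up: "steps (clean_up xs out) \<le> 7 * length xs + 1"
proof (induction xs arbitrary: out)
  case (Cons I xs)
  obtain s e where I: "I = (s, e)" by force
  show ?case
  proof (cases out)
    case Nil
    show ?thesis
      using Cons[of "[(s, e)]"] Cons[of "[]"] by (simp add: I Nil)
  next
    case (Cons J out')
    obtain x y where J: "J = (x, y)" by force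
    show ?thesis
      using Cons.IH[of "(min s x, max e y) # out'"] Cons.IH[of out] Cons.IH[of "(s, e) # out"]
      by (simp add: I J Cons)
  qed
qed simp

lemma length_clean: "length (clean xs out) \<le> length xs + length out"
proof (induction xs arbitrary: out)
  case (Cons I xs)
  obtain s e where I: "I = (s, e)" by force
  show ?case
  proof (cases out)
    case Nil
    show ?thesis
      using Cons[of "[(s, e)]"] Cons[of "[]"] by (simp add: I Nil)
  next
    case (Cons J out')
    obtain x y where J: "J = (x, y)" by force
    show ?thesis
      using Cons.IH[of "(min s x, max e y) # out'"] Cons.IH[of out] Cons.IH[of "(s, e) # out"]
      by (simp add: I J Cons)
  qed
qed simp

text \<open>The third premise keeps the remaining pieces to the left of every start on the output
  stack. A nonempty piece can therefore meet the top interval only in the point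
  \<open>e = x\<close>, which is the one case where merging takes place.\<close>

lemma clean_spec:
  assumes "sorted_wrt later xs" "sep out"
    and "\<forall>(s, e) \<in> set xs. \<forall>(x, y) \<in> set out. s \<le> x \<and> e \<le> x"
  shows "sep (clean xs out) \<and> cov 0 (clean xs out) = cov 0 xs \<union> cov 0 out"
  using assms
proof (induction xs arbitrary: out)
  case (Cons I xs)
  obtain s e where I: "I = (s, e)" by force
  have later: "sorted_wrt later xs" and xs: "\<forall>(s', e') \<in> set xs. s' \<le> s \<and> e' \<le> s"
    using Cons.prems(1) by (auto simp: I)
  have below: "\<forall>(s', e') \<in> set xs. \<forall>(x, y) \<in> set out. s' \<le> x \<and> e' \<le> x"
    using Cons.prems(3) by auto
  show ?case
  proof (cases "s \<le> e")
    case False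
    then have "clean (I # xs) out = clean xs out" "cov 0 (I # xs) = cov 0 xs"
      by (cases out; cases "hd out"; simp add: I cov_Cons)+
    then show ?thesis
      using Cons.IH[OF later Cons.prems(2) below] by simp
  next
    case True
    show ?thesis
    proof (cases out)
      case Nil
      show ?thesis
        using Cons.IH[of "[(s, e)]"] later xs True by (simp add: I Nil sep_Cons cov_Cons Un_commute)
    next
      case (Cons J out')
      obtain x y where J: "J = (x, y)" by force
      have sx: "s \<le> x" "e \<le> x" and xy: "x \<le> y"
        using Cons.prems(2,3) by (simp_all add: Cons J I sep_Cons)
      show ?thesis
      proof (cases "e = x")
        case True
        have "clean (I # xs) out = clean xs ((s, y) # out')"
          using True sx xy by (simp add: I Cons J)
        moreover have "sep ((s, y) # out')"
          using Cons.prems(2) sx xy by (simp add: Cons J sep_Cons)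
        moreover have "{s..y} = {s..e} \<union> {x..y}"
          using True sx xy by auto
        moreover have "\<forall>(s', e') \<in> set xs. \<forall>(x, y) \<in> set ((s, y) # out'). s' \<le> x \<and> e' \<le> x"
          using below xs by (auto simp: Cons)
        ultimately show ?thesis
          using Cons.IH[of "(s, y) # out'"] later
          by (simp add: I Cons J cov_Cons Un_ac)
      next
        case False
        then have "clean (I # xs) out = clean xs ((s, e) # out)"
          using True sx xy by (simp add: I Cons J)
        moreover have "\<forall>(x', y') \<in> set out'. e < x'"
          using Cons.prems(2) sx xy by (auto simp: Cons J sep_Cons)
        then have "sep ((s, e) # out)"
          using Cons.prems(2) sx False True by (simp add: Cons J sep_Cons)
        moreover have "\<forall>(s', e') \<in> set xs. \<forall>(x, y) \<in> set ((s, e) # out). s' \<le> x \<and> e' \<le> x"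
          using below xs by auto
        ultimately show ?thesis
          using Cons.IH[of "(s, e) # out"] later
          by (simp add: I cov_Cons Un_ac)
      qed
    qed
  qed
qed simp

section \<open>The forward step\<close>

lemma result_put_fwd [simp]: "result (put_fwd \<delta> s e lm out) = put \<delta> s e lm @ out"
  by (cases lm) simp_all

lemma steps_put_fwd: "steps (put_fwd \<delta> s e lm out) \<le> (if lm = None then 1 else 3)"
  by (cases lm) simp_all

lemma length_put [simp]: "length (put \<delta> s e lm) = (if lm = None then 0 else 1)"
  by (cases lm) simp_all

text \<open>A round costs at most 8 and pushes one piece, to which it is charged. Only the first
  round can lack a cap and push nothing, whence the additional 8. The second premise keeps the
  skipping test of \<open>pieces\<close> from succeeding.\<close>

lemma scan_fwd:
  assumes "sep (drop q (elems prev))" "\<forall>I \<in> set (drop q (elems prev)). s < fst I"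
  shows "result (scan_fwd \<delta> prev b q s lm out) = pieces \<delta> b s lm (drop q (elems prev)) @ out
    \<and> steps (scan_fwd \<delta> prev b q s lm out)
      \<le> 8 * length (pieces \<delta> b s lm (drop q (elems prev))) + (if lm = None then 8 else 0)"
  using assms
proof (induction "length (elems prev) - q" arbitrary: q s lm out rule: less_induct)
  case less
  show ?case
  proof (cases "q < length (elems prev)")
    case False
    then show ?thesis
      using steps_put_fwd[of \<delta> s b lm out] by (subst (1 2) scan_fwd.simps) auto
  next
    case True
    obtain a' b' where I: "elems prev ! q = (a', b')" by force
    have drop: "drop q (elems prev) = (a', b') # drop (Suc q) (elems prev)"
      using True I by (metis Cons_nth_drop_Suc)
    have s: "s < a'" and sep: "sep (drop (Suc q) (elems prev))"
      and above: "\<forall>I \<in> set (drop (Suc q) (elems prev)). a' < fst I"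
      using less.prems unfolding drop by (auto simp: sep_Cons)
    show ?thesis
    proof (cases "a' \<le> b")
      case overlap: True
      have "length (elems prev) - Suc q < length (elems prev) - q"
        using True by simp
      note IH = less.hyps[OF this sep above, of "Some b'" "put \<delta> s a' lm @ out"]
      have "scan_fwd \<delta> prev b q s lm out = do {
          len \<leftarrow> alen prev; more \<leftarrow> tick True; (a', b') \<leftarrow> aget prev q; overlap \<leftarrow> tick True;
          out' \<leftarrow> put_fwd \<delta> s a' lm out; q' \<leftarrow> tick (q + 1);
          scan_fwd \<delta> prev b q' a' (Some b') out' }"
        using True I overlap by (subst scan_fwd.simps) (simp add: bind_timed_def)
      then show ?thesis
        using IH steps_put_fwd[of \<delta> s a' lm out] s overlap by (auto simp: I drop)
    next
      case False
      then show ?thesis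
        using steps_put_fwd[of \<delta> s b lm out] True I s by (subst (1 2) scan_fwd.simps) (auto simp: drop)
    qed
  qed
qed

text \<open>A prefix of intervals starting at or before \<open>s\<close> leaves only its last end
  behind, as the cap. This is why a binary search may replace the traversal of that prefix.\<close>

lemma pieces_append:
  assumes "\<forall>I \<in> set L1. fst I \<le> s"
  shows "pieces \<delta> b s lm (L1 @ L2)
    = pieces \<delta> b s (if L1 = [] then lm else Some (snd (last L1))) L2"
  using assms by (induction L1 arbitrary: lm) auto

lemma sep_nth: "sep L \<Longrightarrow> i < j \<Longrightarrow> j < length L \<Longrightarrow> snd (L ! i) < fst (L ! j)"
  by (auto simp: sep_def sorted_wrt_iff_nth_less)

lemma sep_nth_le: "sep L \<Longrightarrow> j < length L \<Longrightarrow> fst (L ! j) \<le> snd (L ! j)"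
  by (auto simp: sep_def)

lemma sep_append: "sep (L1 @ L2) \<longleftrightarrow> sep L1 \<and> sep L2 \<and> (\<forall>I \<in> set L1. \<forall>J \<in> set L2. snd I < fst J)"
  by (auto simp: sep_def sorted_wrt_append)

lemma sep_drop: "sep L \<Longrightarrow> sep (drop q L)"
  and sep_take: "sep L \<Longrightarrow> sep (take q L)"
  using sep_append[of "take q L" "drop q L"] by auto

lemma set_take_le:
  assumes "sep L" "q \<le> length L" "0 < q \<Longrightarrow> fst (L ! (q - 1)) \<le> x" "I \<in> set (take q L)"
  shows "fst I \<le> x"
proof -
  obtain i where i: "i < q" "I = L ! i"
    using assms(4) by (auto simp: in_set_conv_nth)
  then show ?thesis
    using assms(1-3) sep_nth[of L i "q - 1"] sep_nth_le[of L i]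
    by (cases "i = q - 1") fastforce+
qed

lemma set_drop_gt:
  assumes "sep L" "q < length L \<Longrightarrow> x < fst (L ! q)" "I \<in> set (drop q L)"
  shows "x < fst I"
proof -
  obtain i where "i < length L - q" "I = L ! (q + i)"
    using assms(3) by (auto simp: in_set_conv_nth)
  then have i: "q + i < length L" "I = L ! (q + i)"
    by simp_all
  then show ?thesis
    using assms(1,2) sep_nth[of L q "q + i"] sep_nth_le[of L q]
    by (cases "i = 0") fastforce+
qed

lemma scan_fwd_at:
  assumes "sep (elems prev)" "q \<le> length (elems prev)"
    and "0 < q \<Longrightarrow> fst (elems prev ! (q - 1)) \<le> a"
    and "q < length (elems prev) \<Longrightarrow> a < fst (elems prev ! q)"
    and "lm = (if q = 0 then None else Some (snd (elems prev ! (q - 1))))"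
  shows "result (scan_fwd \<delta> prev b q a lm out) = pieces \<delta> b a None (elems prev) @ out"
    and "steps (scan_fwd \<delta> prev b q a lm out)
      \<le> 8 * length (pieces \<delta> b a None (elems prev)) + (if q = 0 then 8 else 0)"
proof -
  let ?L = "elems prev"
  have last: "last (take q ?L) = ?L ! (q - 1)" if "0 < q"
    using that assms(2) by (subst last_conv_nth) (auto simp: min_def)
  have "\<forall>I \<in> set (take q ?L). fst I \<le> a"
    using set_take_le[OF assms(1,2,3)] by blast
  from pieces_append[OF this, of \<delta> b None "drop q ?L"]
  have pieces: "pieces \<delta> b a None ?L = pieces \<delta> b a lm (drop q ?L)"
    unfolding assms(5) using last assms(2) by (cases "q = 0") auto
  have "\<forall>I \<in> set (drop q ?L). a < fst I"
    using set_drop_gt[OF assms(1,4)] by blast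
  note scan_fwd[OF sep_drop[OF assms(1)] this, of \<delta> b lm out]
  then show "result (scan_fwd \<delta> prev b q a lm out) = pieces \<delta> b a None ?L @ out"
    and "steps (scan_fwd \<delta> prev b q a lm out)
      \<le> 8 * length (pieces \<delta> b a None ?L) + (if q = 0 then 8 else 0)"
    unfolding pieces by (simp_all add: assms(5) split: if_splits)
qed

lemma result_bsearch_empty [simp]: "result (bsearch P lo lo) = lo"
  by (subst bsearch.simps) simp

text \<open>With \<open>m\<close> the first interval ending at or after \<open>a\<close>, the scan
  begins at \<open>m + 1\<close> if interval \<open>m\<close> contains \<open>a\<close>, and at
  \<open>m\<close> otherwise. In both cases exactly the intervals before that position start at or
  before \<open>a\<close>, as \<open>scan_fwd_at\<close> requires. The 16 includes the round that
  may push nothing.\<close>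

lemma split_fwd:
  assumes sep: "sep (elems prev)" and t: "length (elems prev) < 2 ^ t"
  shows "result (split_fwd \<delta> prev (a, b) out) = pieces \<delta> b a None (elems prev) @ out
    \<and> steps (split_fwd \<delta> prev (a, b) out)
      \<le> 6 * t + 16 + 8 * length (pieces \<delta> b a None (elems prev))"
proof -
  let ?L = "elems prev"
  let ?P = "\<lambda>j. do { (a', b') \<leftarrow> aget prev j; tick (a \<le> b') }"
  define m where "m = result (bsearch ?P 0 (length ?L))"
  have P: "result (?P j) = (a \<le> snd (?L ! j))" "steps (?P j) = 2" for j
    by (simp_all split: prod.split)
  have m: "m \<le> length ?L" "m < length ?L \<Longrightarrow> a \<le> snd (?L ! m)"
    "0 < m \<Longrightarrow> snd (?L ! (m - 1)) < a"
    using result_bsearch[of 0 "length ?L" ?P] unfolding m_def[symmetric] P by auto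
  have bs: "steps (bsearch ?P 0 (length ?L)) \<le> 6 * t + 1"
    using steps_bsearch[of ?P 2 "length ?L" 0 t] P(2) t by simp
  note m_def' = m_def[unfolded split_def]
  note bs' = bs[unfolded split_def]
  show ?thesis
  proof (cases "m < length ?L \<and> fst (?L ! m) \<le> a")
    case True
    have "a < fst (?L ! Suc m)" if "Suc m < length ?L"
      using m(2) sep_nth[OF sep, of m "Suc m"] that by simp
    then show ?thesis
      using scan_fwd_at[OF sep, of "Suc m" a "Some (snd (?L ! m))" \<delta> b out] True bs'
      by (simp add: split_fwd_def split_def m_def'[symmetric])
  next
    case False
    have A: "fst (?L ! (m - 1)) \<le> a" if "0 < m"
      using m(1,3) sep_nth_le[OF sep, of "m - 1"] that by fastforce
    have B: "a < fst (?L ! m)" if "m < length ?L"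
      using that False by simp
    define N where "N = result (alen prev)"
    then have N: "length ?L = N" and N': "result (alen prev) = N"
      by simp_all
    have m_N: "result (bsearch ?P 0 N) = m"
      using m_def N by simp
    note m_N = m_N[unfolded split_def]
    define lm where "lm = (if m = 0 then None else Some (snd (?L ! (m - 1))))"
    have scan: "result (scan_fwd \<delta> prev b m a lm out) = pieces \<delta> b a None ?L @ out"
      "steps (scan_fwd \<delta> prev b m a lm out) \<le> 8 * length (pieces \<delta> b a None ?L) + (if m = 0 then 8 else 0)"
      using scan_fwd_at[OF sep m(1) A B lm_def, of \<delta> b out] by auto
    have "result (split_fwd \<delta> prev (a, b) out) = result (scan_fwd \<delta> prev b m a lm out)
      \<and> steps (split_fwd \<delta> prev (a, b) out) \<le> steps (bsearch ?P 0 (length ?L))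
        + steps (scan_fwd \<delta> prev b m a lm out) + (if m = 0 then 6 else 8)"
      using False unfolding N by (cases "m < N"; cases "m = 0")
        (simp_all add: split_fwd_def split_def m_N lm_def N' del: result_alen)
    then show ?thesis
      using scan bs by (simp split: if_splits)
  qed
qed

text \<open>Since scans are charged to the pieces they push, their costs add up to the total number
  of pieces; each interval of \<open>cur\<close> pays only for its search and a constant.\<close>

lemma subdivide_fwd:
  assumes sep: "sep (elems prev)" and t: "length (elems prev) < 2 ^ t"
  shows "result (subdivide_fwd \<delta> prev cur j out) = subs \<delta> (elems prev) (drop j (elems cur)) @ out
    \<and> steps (subdivide_fwd \<delta> prev cur j out)
      \<le> (6 * t + 20) * (length (elems cur) - j)
        + 8 * length (subs \<delta> (elems prev) (drop j (elems cur))) + 2"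
proof (induction "length (elems cur) - j" arbitrary: j out)
  case 0
  then show ?case
    by (subst (1 2) subdivide_fwd.simps) auto
next
  case (Suc l)
  then have j: "j < length (elems cur)" "l = length (elems cur) - Suc j"
    by auto
  obtain a b where I: "elems cur ! j = (a, b)" by force
  have drop: "drop j (elems cur) = (a, b) # drop (Suc j) (elems cur)"
    using j I by (metis Cons_nth_drop_Suc)
  have len: "length (elems cur) - j = Suc (length (elems cur) - Suc j)"
    using j by simp
  show ?case
    using Suc.hyps(1)[OF j(2), of "pieces \<delta> b a None (elems prev) @ out"]
      split_fwd[OF sep t, of \<delta> a b out] j(1)
    by (subst (1 2) subdivide_fwd.simps) (simp add: I drop len subs_Cons)
qed

text \<open>Serves both directions: the backward sweep applies it to reflected lists.\<close>

definition step :: "real \<Rightarrow> interval list \<Rightarrow> interval list \<Rightarrow> interval list" where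
  "step \<delta> L C = clean (subs \<delta> L C) []"

lemma step_spec:
  assumes "sep L" "sep C"
  shows "sep (step \<delta> L C)" "cov 0 (step \<delta> L C) = cov 0 C \<inter> cov \<delta> L"
    "length (step \<delta> L C) \<le> length C + length L"
proof -
  show "sep (step \<delta> L C)" "cov 0 (step \<delta> L C) = cov 0 C \<inter> cov \<delta> L"
    unfolding step_def
    using clean_spec[OF subs_later[OF assms(2)], of "[]" \<delta> L] cov_subs[OF assms(2,1), of \<delta>]
    by simp_all
  show "length (step \<delta> L C) \<le> length C + length L"
    unfolding step_def using length_clean[of "subs \<delta> L C" "[]"] length_subs[OF assms(2), of \<delta> L] by simp
qed

lemma step_fwd:
  assumes sep: "sep (elems prev)" "sep (elems cur)" and t: "length (elems prev) < 2 ^ t"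
  shows "elems (result (step_fwd \<delta> prev cur)) = step \<delta> (elems prev) (elems cur)"
    "steps (step_fwd \<delta> prev cur) \<le> (6 * t + 36) * (length (elems cur) + length (elems prev)) + 10"
proof -
  let ?S = "subs \<delta> (elems prev) (elems cur)"
  have sub: "result (subdivide_fwd \<delta> prev cur 0 []) = ?S"
    "steps (subdivide_fwd \<delta> prev cur 0 []) \<le> (6 * t + 20) * length (elems cur) + 8 * length ?S + 2"
    using subdivide_fwd[OF sep(1) t, of \<delta> cur 0 "[]"] by simp_all
  show "elems (result (step_fwd \<delta> prev cur)) = step \<delta> (elems prev) (elems cur)"
    by (simp add: step_fwd_def step_def clean_def sub)
  \<comment> \<open>The 16 per piece is 8 for producing it, 7 for cleaning up and 1 for the copy
    into the array.\<close>
  have "steps (step_fwd \<delta> prev cur) \<le> (6 * t + 20) * length (elems cur) + 16 * length ?S + 4"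
    using sub steps_clean_up[of ?S "[]"] length_clean[of ?S "[]"]
    by (simp add: step_fwd_def clean_def)
  moreover have "length ?S \<le> length (elems cur) + length (elems prev)"
    using length_subs[OF sep(2)] .
  ultimately show "steps (step_fwd \<delta> prev cur)
      \<le> (6 * t + 36) * (length (elems cur) + length (elems prev)) + 10"
    by (simp add: algebra_simps)
qed

section \<open>The backward step\<close>

text \<open>Up to the reflection \<open>x \<mapsto> - x\<close>, the backward step computes the same list as the forward step.\<close>

fun neg :: "interval \<Rightarrow> interval" where
  "neg (a, b) = (- b, - a)"

lemma fst_neg [simp]: "fst (neg I) = - snd I"
  and snd_neg [simp]: "snd (neg I) = - fst I"
  and neg_neg [simp]: "neg (neg I) = I"
  by (cases I; simp)+

definition mir :: "interval list \<Rightarrow> interval list" where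
  "mir L = rev (map neg L)"

lemma mir_Nil [simp]: "mir [] = []"
  and mir_eq_Nil [simp]: "mir L = [] \<longleftrightarrow> L = []"
  and mir_append: "mir (L @ L') = mir L' @ mir L"
  and length_mir [simp]: "length (mir L) = length L"
  and set_mir [simp]: "set (mir L) = neg ` set L"
  by (simp_all add: mir_def)

lemma sep_mir [simp]: "sep (mir L) \<longleftrightarrow> sep L"
  by (simp add: sep_def mir_def sorted_wrt_rev sorted_wrt_map)

text \<open>Reflecting \<open>[a, b]\<close> and extending by \<delta> gives
  \<open>[- b, - a + \<delta>]\<close>, the reflection of \<open>[a - \<delta>, b]\<close>, which
  holds the points from which \<open>[a, b]\<close> is reached in time \<delta>. This is
  \<open>[a, b + \<delta>]\<close> shifted by -\<delta>, so one notion of coverage suffices for both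
  sweeps.\<close>

lemma cov_mir: "x \<in> cov \<delta> (mir L) \<longleftrightarrow> \<delta> - x \<in> cov \<delta> L"
proof -
  have "(- b \<le> x \<and> x \<le> - a + \<delta>) = (a \<le> \<delta> - x \<and> \<delta> - x \<le> b + \<delta>)" for a b
    by auto
  then show ?thesis
    by (simp add: cov_def split_def)
qed

lemma result_put_bwd [simp]:
  "result (put_bwd \<delta> s e lm out) = map neg (put \<delta> (- e) (- s) (map_option uminus lm)) @ out"
  by (cases lm) (simp_all add: min_def max_def)

lemma steps_put_bwd: "steps (put_bwd \<delta> s e lm out) \<le> (if lm = None then 1 else 3)"
  by (cases lm) simp_all

text \<open>Descending through \<open>take q\<close> is ascending through its mirror image, with
  lower bounds on starts turned into upper bounds on ends.\<close>

lemma scan_bwd: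
  assumes "q \<le> length (elems nxt)" "sep (elems nxt)" "\<forall>I \<in> set (take q (elems nxt)). snd I < e"
  shows "result (scan_bwd \<delta> nxt a q e lm out)
      = map neg (pieces \<delta> (- a) (- e) (map_option uminus lm) (mir (take q (elems nxt)))) @ out
    \<and> steps (scan_bwd \<delta> nxt a q e lm out)
      \<le> 8 * length (pieces \<delta> (- a) (- e) (map_option uminus lm) (mir (take q (elems nxt))))
        + (if lm = None then 8 else 0)"
  using assms
proof (induction q arbitrary: e lm out)
  case 0
  then show ?case
    using steps_put_bwd[of \<delta> a e lm out] by (subst (1 2) scan_bwd.simps) auto
next
  case (Suc q)
  obtain a' b' where I: "elems nxt ! q = (a', b')" by force
  have take: "take (Suc q) (elems nxt) = take q (elems nxt) @ [(a', b')]"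
    using Suc.prems(1) I by (metis Suc_le_lessD take_Suc_conv_app_nth)
  then have mir: "mir (take (Suc q) (elems nxt)) = (- b', - a') # mir (take q (elems nxt))"
    by (simp add: mir_def)
  have "sep (take q (elems nxt) @ [(a', b')])"
    using sep_take[OF Suc.prems(2), of "Suc q"] take by simp
  then have below: "\<forall>I \<in> set (take q (elems nxt)). snd I < b'" and e: "b' < e"
    using Suc.prems(3) unfolding take by (auto simp: sep_append sep_Cons)
  show ?case
  proof (cases "a \<le> b'")
    case True
    have "scan_bwd \<delta> nxt a (Suc q) e lm out = do {
        more \<leftarrow> tick True; q' \<leftarrow> tick q; (a', b') \<leftarrow> aget nxt q; overlap \<leftarrow> tick True;
        out' \<leftarrow> put_bwd \<delta> b' e lm out; scan_bwd \<delta> nxt a q b' (Some a') out' }"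
      using I True by (subst scan_bwd.simps) (simp add: bind_timed_def)
    then show ?thesis
      using Suc.IH[OF _ Suc.prems(2) below, of "Some a'" "result (put_bwd \<delta> b' e lm out)"]
        Suc.prems(1) steps_put_bwd[of \<delta> b' e lm out] True e
      by (auto simp: I mir)
  next
    case False
    then show ?thesis
      using steps_put_bwd[of \<delta> a e lm out] e
      by (subst (1 2) scan_bwd.simps) (auto simp: I mir)
  qed
qed

lemma scan_bwd_at:
  assumes sep: "sep (elems nxt)" and "q \<le> length (elems nxt)"
    and "0 < q \<Longrightarrow> snd (elems nxt ! (q - 1)) < b"
    and "q < length (elems nxt) \<Longrightarrow> b \<le> snd (elems nxt ! q)"
    and "lm = (if q < length (elems nxt) then Some (fst (elems nxt ! q)) else None)"
  shows "result (scan_bwd \<delta> nxt a q b lm out)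
      = map neg (pieces \<delta> (- a) (- b) None (mir (elems nxt))) @ out"
    and "steps (scan_bwd \<delta> nxt a q b lm out)
      \<le> 8 * length (pieces \<delta> (- a) (- b) None (mir (elems nxt)))
        + (if q < length (elems nxt) then 0 else 8)"
proof -
  let ?L = "elems nxt"
  have last: "last (mir (drop q ?L)) = neg (?L ! q)" if "q < length ?L"
    using that by (simp add: mir_def last_rev hd_map hd_drop_conv_nth)
  have "b \<le> snd I" if I: "I \<in> set (drop q ?L)" for I
  proof -
    obtain i where "i < length ?L - q" "I = ?L ! (q + i)"
      using I by (auto simp: in_set_conv_nth)
    then have i: "q + i < length ?L" "I = ?L ! (q + i)"
      by simp_all
    then show ?thesis
      using assms(4) sep_nth[OF sep, of q "q + i"] sep_nth_le[OF sep, of "q + i"]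
      by (cases "i = 0") fastforce+
  qed
  then have "\<forall>I \<in> set (mir (drop q ?L)). fst I \<le> - b"
    by simp
  from pieces_append[OF this, of \<delta> "- a" None "mir (take q ?L)"]
  have "pieces \<delta> (- a) (- b) None (mir (drop q ?L) @ mir (take q ?L))
      = pieces \<delta> (- a) (- b) (map_option uminus lm) (mir (take q ?L))"
    unfolding assms(5) using last assms(2) by (cases "q = length ?L") auto
  then have pieces: "pieces \<delta> (- a) (- b) None (mir ?L)
      = pieces \<delta> (- a) (- b) (map_option uminus lm) (mir (take q ?L))"
    by (metis mir_append append_take_drop_id)
  have "snd I < b" if I: "I \<in> set (take q ?L)" for I
  proof -
    obtain i where i: "i < q" "I = ?L ! i"
      using I by (auto simp: in_set_conv_nth)
    then show ?thesis
      using assms(2,3) sep_nth[OF sep, of i "q - 1"] sep_nth_le[OF sep, of "q - 1"]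
      by (cases "i = q - 1") fastforce+
  qed
  then have "\<forall>I \<in> set (take q ?L). snd I < b"
    by blast
  note scan_bwd[OF assms(2) sep this, of \<delta> a lm out]
  then show "result (scan_bwd \<delta> nxt a q b lm out)
      = map neg (pieces \<delta> (- a) (- b) None (mir ?L)) @ out"
    and "steps (scan_bwd \<delta> nxt a q b lm out)
      \<le> 8 * length (pieces \<delta> (- a) (- b) None (mir ?L)) + (if q < length ?L then 0 else 8)"
    unfolding pieces by (simp_all add: assms(5) split: if_splits)
qed

text \<open>The search yields the first interval starting after \<open>b\<close>; only its
  predecessor can contain \<open>b\<close>, hence the index \<open>m - 1\<close> in the containing
  case and \<open>m\<close> for the scan otherwise.\<close>

lemma split_bwd:
  assumes sep: "sep (elems nxt)" and t: "length (elems nxt) < 2 ^ t"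
  shows "result (split_bwd \<delta> nxt (a, b) out)
      = map neg (pieces \<delta> (- a) (- b) None (mir (elems nxt))) @ out
    \<and> steps (split_bwd \<delta> nxt (a, b) out)
      \<le> 6 * t + 16 + 8 * length (pieces \<delta> (- a) (- b) None (mir (elems nxt)))"
proof -
  let ?L = "elems nxt"
  let ?P = "\<lambda>j. do { (a', b') \<leftarrow> aget nxt j; tick (b < a') }"
  define m where "m = result (bsearch ?P 0 (length ?L))"
  have P: "result (?P j) = (b < fst (?L ! j))" "steps (?P j) = 2" for j
    by (simp_all split: prod.split)
  have m: "m \<le> length ?L" "m < length ?L \<Longrightarrow> b < fst (?L ! m)"
    "0 < m \<Longrightarrow> fst (?L ! (m - 1)) \<le> b"
    using result_bsearch[of 0 "length ?L" ?P] unfolding m_def[symmetric] P by auto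
  have bs: "steps (bsearch ?P 0 (length ?L)) \<le> 6 * t + 1"
    using steps_bsearch[of ?P 2 "length ?L" 0 t] P(2) t by simp
  note m_def' = m_def[unfolded split_def]
  note bs' = bs[unfolded split_def]
  show ?thesis
  proof (cases "0 < m \<and> b \<le> snd (?L ! (m - 1))")
    case True
    have "snd (?L ! (m - 1 - 1)) < b" if "0 < m - 1"
      using m(1,3) sep_nth[OF sep, of "m - 1 - 1" "m - 1"] that by fastforce
    moreover obtain k where k: "m = Suc k"
      using True by (cases m) auto
    ultimately have "result (scan_bwd \<delta> nxt a k b (Some (fst (?L ! k))) out)
        = map neg (pieces \<delta> (- a) (- b) None (mir ?L)) @ out"
      "steps (scan_bwd \<delta> nxt a k b (Some (fst (?L ! k))) out)
        \<le> 8 * length (pieces \<delta> (- a) (- b) None (mir ?L))"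
      using scan_bwd_at[OF sep, of k b "Some (fst (?L ! k))" \<delta> a out] True m(1) by auto
    then show ?thesis
      using True bs' by (simp add: split_bwd_def split_def m_def'[symmetric] k)
  next
    case False
    have A: "b \<le> snd (?L ! m)" if "m < length ?L"
      using m(2) sep_nth_le[OF sep, of m] that by fastforce
    have B: "snd (?L ! (m - 1)) < b" if "0 < m"
      using that False by simp
    define N where "N = result (alen nxt)"
    then have N: "length ?L = N" and N': "result (alen nxt) = N"
      by simp_all
    have m_N: "result (bsearch ?P 0 N) = m"
      using m_def N by simp
    note m_N = m_N[unfolded split_def]
    define lm where "lm = (if m < length ?L then Some (fst (?L ! m)) else None)"
    have scan: "result (scan_bwd \<delta> nxt a m b lm out)
        = map neg (pieces \<delta> (- a) (- b) None (mir ?L)) @ out"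
      "steps (scan_bwd \<delta> nxt a m b lm out)
        \<le> 8 * length (pieces \<delta> (- a) (- b) None (mir ?L)) + (if m < length ?L then 0 else 8)"
      using scan_bwd_at[OF sep m(1) B A lm_def, of \<delta> a out] by auto
    have "result (split_bwd \<delta> nxt (a, b) out) = result (scan_bwd \<delta> nxt a m b lm out)
      \<and> steps (split_bwd \<delta> nxt (a, b) out) \<le> steps (bsearch ?P 0 (length ?L))
        + steps (scan_bwd \<delta> nxt a m b lm out) + (if m < length ?L then 7 else 6)"
      using False unfolding N by (cases "m < N"; cases "m = 0")
        (simp_all add: split_bwd_def split_def m_N lm_def[unfolded N] N' del: result_alen)
    then show ?thesis
      using scan bs by (simp split: if_splits)
  qed
qed

lemma subdivide_bwd:
  assumes sep: "sep (elems nxt)" and t: "length (elems nxt) < 2 ^ t" and "j \<le> length (elems cur)"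
  shows "result (subdivide_bwd \<delta> nxt cur j out)
      = map neg (subs \<delta> (mir (elems nxt)) (mir (take j (elems cur)))) @ out
    \<and> steps (subdivide_bwd \<delta> nxt cur j out)
      \<le> (6 * t + 20) * j + 8 * length (subs \<delta> (mir (elems nxt)) (mir (take j (elems cur)))) + 2"
  using assms(3)
proof (induction j arbitrary: out)
  case 0
  then show ?case
    by (subst (1 2) subdivide_bwd.simps) auto
next
  case (Suc j)
  obtain a b where I: "elems cur ! j = (a, b)" by force
  have "take (Suc j) (elems cur) = take j (elems cur) @ [(a, b)]"
    using Suc.prems(1) I by (metis Suc_le_lessD take_Suc_conv_app_nth)
  then have mir: "mir (take (Suc j) (elems cur)) = (- b, - a) # mir (take j (elems cur))"
    by (simp add: mir_def)
  show ?case
    using Suc.IH[of "result (split_bwd \<delta> nxt (a, b) out)"] Suc.prems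
      split_bwd[OF sep t, of \<delta> a b out]
    by (subst (1 2) subdivide_bwd.simps) (simp add: I mir subs_Cons)
qed

text \<open>Negation swaps the two comparisons of the overlap test and exchanges \<open>min\<close>
  with \<open>max\<close>, so one clean-up routine works on lists of either direction.\<close>

lemma clean_neg: "clean (map neg xs) (map neg out) = map neg (clean xs out)"
proof (induction xs arbitrary: out)
  case (Cons I xs)
  obtain s e where I: "I = (s, e)" by force
  show ?case
  proof (cases out)
    case Nil
    show ?thesis
      using Cons[of "[(s, e)]"] Cons[of "[]"] by (simp add: I Nil)
  next
    case (Cons J out')
    obtain x y where J: "J = (x, y)" by force
    show ?thesis
      using Cons.IH[of "(min s x, max e y) # out'"] Cons.IH[of out] Cons.IH[of "(s, e) # out"]
      by (auto simp: I J Cons minus_max_eq_min minus_min_eq_max)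
  qed
qed simp

lemma step_bwd:
  assumes sep: "sep (elems nxt)" "sep (elems cur)" and t: "length (elems nxt) < 2 ^ t"
  shows "elems (result (step_bwd \<delta> nxt cur)) = mir (step \<delta> (mir (elems nxt)) (mir (elems cur)))"
    "steps (step_bwd \<delta> nxt cur) \<le> (6 * t + 40) * (length (elems cur) + length (elems nxt)) + 10"
proof -
  let ?S = "subs \<delta> (mir (elems nxt)) (mir (elems cur))"
  have sub: "result (subdivide_bwd \<delta> nxt cur (length (elems cur)) []) = map neg ?S"
    "steps (subdivide_bwd \<delta> nxt cur (length (elems cur)) [])
      \<le> (6 * t + 20) * length (elems cur) + 8 * length ?S + 2"
    using subdivide_bwd[OF sep(1) t, of "length (elems cur)" cur \<delta> "[]"] by simp_all
  have clean: "result (clean_up (map neg ?S) []) = map neg (clean ?S [])"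
    using clean_neg[of ?S "[]"] by (simp add: clean_def)
  show "elems (result (step_bwd \<delta> nxt cur)) = mir (step \<delta> (mir (elems nxt)) (mir (elems cur)))"
    by (simp add: step_bwd_def step_def sub clean) (simp add: mir_def)
  \<comment> \<open>One more per piece than in the forward step, for
    \<open>rev_onto\<close>.\<close>
  have "steps (step_bwd \<delta> nxt cur) \<le> (6 * t + 20) * length (elems cur) + 17 * length ?S + 10"
    using sub steps_clean_up[of "map neg ?S" "[]"] length_clean[of ?S "[]"]
    by (simp add: step_bwd_def clean)
  moreover have "length ?S \<le> length (elems cur) + length (elems nxt)"
    using length_subs[of "mir (elems cur)" \<delta> "mir (elems nxt)"] sep(2) by simp
  ultimately show "steps (step_bwd \<delta> nxt cur)
      \<le> (6 * t + 40) * (length (elems cur) + length (elems nxt)) + 10"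
    by (simp add: algebra_simps)
qed

section \<open>Gaps\<close>

fun gaps :: "interval list \<Rightarrow> (real \<times> real) set" where
  "gaps ((a, b) # (a', b') # L) = insert (b, a') (gaps ((a', b') # L))"
| "gaps _ = {}"

lemma finite_gaps [simp]: "finite (gaps L)"
  by (induction L rule: gaps.induct) auto

lemma sep_cov_ge: "sep ((a, b) # L) \<Longrightarrow> x \<in> cov 0 ((a, b) # L) \<Longrightarrow> a \<le> x"
  by (fastforce simp: sep_Cons cov_def)

lemma gapsD:
  assumes "sep L" "(g, h) \<in> gaps L"
  shows "g < h" "g \<in> cov 0 L" "h \<in> cov 0 L" "x \<in> cov 0 L \<Longrightarrow> x \<le> g \<or> h \<le> x"
proof -
  have "g < h \<and> g \<in> cov 0 L \<and> h \<in> cov 0 L \<and> (\<forall>x \<in> cov 0 L. x \<le> g \<or> h \<le> x)"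
    using assms
  proof (induction L rule: gaps.induct)
    case (1 a b a' b' L)
    let ?L = "(a', b') # L"
    have L: "sep ?L" "b < a'" "a \<le> b" "a' \<le> b'"
      using "1.prems"(1) by (auto simp: sep_Cons)
    have cov: "cov 0 ((a, b) # ?L) = {a..b} \<union> cov 0 ?L"
      by (simp add: cov_Cons)
    have ge: "a' \<le> x" if "x \<in> cov 0 ?L" for x
      using sep_cov_ge[OF L(1) that] .
    show ?case
    proof (cases "(g, h) = (b, a')")
      case True
      have "a' \<in> cov 0 ?L"
        using L by (simp add: cov_Cons)
      then show ?thesis
        unfolding cov using True L ge by auto
    next
      case False
      then have IH: "g < h" "g \<in> cov 0 ?L" "h \<in> cov 0 ?L" "\<forall>x \<in> cov 0 ?L. x \<le> g \<or> h \<le> x"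
        using "1.IH" "1.prems"(2) L(1) by auto
      then show ?thesis
        unfolding cov using L(2) ge[OF IH(2)] by fastforce
    qed
  qed auto
  then show "g < h" "g \<in> cov 0 L" "h \<in> cov 0 L" "x \<in> cov 0 L \<Longrightarrow> x \<le> g \<or> h \<le> x"
    by auto
qed

lemma card_gaps: "sep L \<Longrightarrow> card (gaps L) = length L - 1"
proof (induction L rule: gaps.induct)
  case (1 a b a' b' L)
  have L: "sep ((a', b') # L)" "b < a'"
    using "1.prems" by (auto simp: sep_Cons)
  have "(b, a') \<notin> gaps ((a', b') # L)"
    using gapsD(2)[OF L(1)] sep_cov_ge[OF L(1)] L(2) by fastforce
  then show ?case
    using "1.IH" L(1) by simp
qed auto

text \<open>Containment of open intervals with \<open>J\<close> nonempty; nonemptiness is required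
  because the trace \<open>(g + \<delta>, h)\<close> of a gap vanishes once \<delta> is as long as
  the gap.\<close>

definition inside :: "real \<times> real \<Rightarrow> real \<times> real \<Rightarrow> bool" where
  "inside J K \<longleftrightarrow> fst K \<le> fst J \<and> fst J < snd J \<and> snd J \<le> snd K"

text \<open>Gaps of a separated list are pairwise disjoint, so a nonempty interval lies in at most
  one of them, and choosing a member of \<open>V\<close> inside each gap is injective.\<close>

lemma card_gaps_le:
  assumes sep: "sep L" and "W \<subseteq> gaps L" "finite V" and V: "\<forall>K \<in> W. \<exists>J \<in> V. inside J K"
  shows "card W \<le> card V"
proof -
  obtain f where f: "\<forall>K \<in> W. f K \<in> V \<and> inside (f K) K"
    using bchoice[OF V[unfolded Bex_def]] by auto
  have "K = K'" if "K \<in> W" "K' \<in> W" "f K = f K'" for K K'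
  proof -
    obtain g h g' h' where K: "K = (g, h)" "K' = (g', h')"
      by fastforce
    have in_gaps: "(g, h) \<in> gaps L" "(g', h') \<in> gaps L"
      using that(1,2) assms(2) unfolding K by blast+
    have "inside (f K) (g, h)" "inside (f K) (g', h')"
      using f that unfolding K by (metis, metis)
    then have "g < h'" "g' < h"
      by (auto simp: inside_def)
    then show ?thesis
      using gapsD(4)[OF sep in_gaps(1) gapsD(2)[OF sep in_gaps(2)]]
        gapsD(4)[OF sep in_gaps(1) gapsD(3)[OF sep in_gaps(2)]]
        gapsD(4)[OF sep in_gaps(2) gapsD(2)[OF sep in_gaps(1)]]
        gapsD(4)[OF sep in_gaps(2) gapsD(3)[OF sep in_gaps(1)]]
      unfolding K by auto
  qed
  then have "inj_on f W"
    by (auto intro: inj_onI)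
  then show ?thesis
    using card_inj_on_le[of f W V] f assms(3) by auto
qed

text \<open>Take the last interval that starts at or before \<open>x\<close>. As \<open>x\<close> is
  uncovered, its reach ends before \<open>x\<close>; as \<open>w\<close> is covered, there is a next
  interval, starting in \<open>(x, w]\<close>. The interval \<open>(a, b)\<close> carries the bound
  \<open>u\<close> through the induction: ends increase, so the next interval can replace it when
  the head is dropped.\<close>

lemma locate_gap:
  assumes "sep L" "(a, b) \<in> set L" "a \<le> x" "u \<le> b + \<delta>" "w \<in> cov \<delta> L" "x < w" "x \<notin> cov \<delta> L"
  shows "\<exists>(g, h) \<in> gaps L. u \<le> g + \<delta> \<and> g + \<delta> < x \<and> x < h \<and> h \<le> w"
  using assms
proof (induction L arbitrary: a b rule: gaps.induct)
  case (1 a1 b1 a2 b2 L)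
  let ?L = "(a2, b2) # L"
  have L: "sep ?L" "b1 < a2" "a1 \<le> b1" "a2 \<le> b2"
    using "1.prems"(1) by (auto simp: sep_Cons)
  have cov: "cov \<delta> ((a1, b1) # ?L) = {a1..b1 + \<delta>} \<union> cov \<delta> ?L"
    by (simp add: cov_Cons)
  have starts: "a2 \<le> s" if "(s, e) \<in> set ?L" for s e
    using that L(1) by (auto simp: sep_Cons)
  show ?case
  proof (cases "x < a2")
    case True
    then have ab: "(a, b) = (a1, b1)"
      using "1.prems"(2,3) starts[of a b] by auto
    then have x: "b1 + \<delta> < x"
      using "1.prems"(3,7) unfolding cov by auto
    then have "w \<in> cov \<delta> ?L"
      using "1.prems"(5,6) unfolding cov by auto
    then have "a2 \<le> w"
      using starts unfolding cov_def by fastforce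
    then show ?thesis
      using True x ab "1.prems"(4) by auto
  next
    case False
    have x: "x \<notin> cov \<delta> ?L"
      using "1.prems"(7) unfolding cov by blast
    then have x2: "b2 + \<delta> < x"
      using False by (auto simp: cov_Cons)
    then have w: "w \<in> cov \<delta> ?L"
      using "1.prems"(5,6) L unfolding cov by auto
    have "\<exists>(a', b') \<in> set ?L. a' \<le> x \<and> u \<le> b' + \<delta>"
      using "1.prems"(2,3,4) False L by auto
    then obtain a' b' where "(a', b') \<in> set ?L" "a' \<le> x" "u \<le> b' + \<delta>"
      by blast
    from "1.IH"[OF L(1) this w "1.prems"(6) x] show ?thesis
      by auto
  qed
qed (auto simp: cov_def)

lemma gap_between:
  assumes "sep L" "u \<in> cov \<delta> L" "w \<in> cov \<delta> L" "u < x" "x < w" "x \<notin> cov \<delta> L"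
  obtains g h where "(g, h) \<in> gaps L" "u \<le> g + \<delta>" "g + \<delta> < x" "x < h" "h \<le> w"
proof -
  obtain a b where "(a, b) \<in> set L" "a \<le> u" "u \<le> b + \<delta>"
    using assms(2) by (auto simp: cov_def)
  then have "\<exists>(g, h) \<in> gaps L. u \<le> g + \<delta> \<and> g + \<delta> < x \<and> x < h \<and> h \<le> w"
    using assms(4) by (intro locate_gap[OF assms(1) _ _ _ assms(3,5,6)]) auto
  then show ?thesis
    using that by blast
qed

section \<open>Witnesses for the gaps added by the backward sweep\<close>

text \<open>\<open>u\<close> bounds the number of gaps of \<open>B\<close> that contain no gap of \<open>F\<close>; \<open>U\<close> has one witness for each of them.\<close>

definition controlled :: "interval list \<Rightarrow> interval list \<Rightarrow> nat \<Rightarrow> bool" where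
  "controlled F B u \<longleftrightarrow> cov 0 B \<subseteq> cov 0 F
    \<and> (\<exists>U. finite U \<and> card U \<le> u \<and> (\<forall>K \<in> gaps B. \<exists>J \<in> gaps F \<union> U. inside J K))"

text \<open>The start of the backward sweep, whose first list is the last forward list
  itself.\<close>

lemma controlled_refl: "sep F \<Longrightarrow> controlled F F 0"
proof -
  assume "sep F"
  then have "inside K K" if "K \<in> gaps F" for K
    using gapsD(1)[of F "fst K" "snd K"] that by (simp add: inside_def)
  then have "\<forall>K \<in> gaps F. \<exists>J \<in> gaps F \<union> {}. inside J K"
    by blast
  then show ?thesis
    unfolding controlled_def by (intro conjI exI[of _ "{}"]) simp_all
qed

text \<open>By \<open>card_gaps_le\<close>, distinct gaps of \<open>B\<close> contain distinct
  members of \<open>gaps F \<union> U\<close>; the 1 converts gaps back into intervals.\<close>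

lemma length_controlled:
  assumes "controlled F B u" "sep F" "sep B"
  shows "length B \<le> length F + u + 1"
proof -
  obtain U where U: "finite U" "card U \<le> u" "\<forall>K \<in> gaps B. \<exists>J \<in> gaps F \<union> U. inside J K"
    using assms(1) by (auto simp: controlled_def)
  have "card (gaps B) \<le> card (gaps F \<union> U)"
    using card_gaps_le[OF assms(3) order_refl _ U(3)] U(1) by simp
  also have "\<dots> \<le> card (gaps F) + card U"
    by (rule card_Un_le)
  finally show ?thesis
    using U(2) card_gaps assms(2,3) by simp
qed

text \<open>Both ends of the gap lie in \<open>I\<close> and in the reach of \<open>F\<close>, while
  its midpoint misses one of the two; \<open>gap_between\<close> then finds a gap of that
  one.\<close>

lemma inside_forward:
  assumes sep: "sep F'" "sep I" "sep F" and F': "cov 0 F' = cov 0 I \<inter> cov \<delta> F"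
    and K: "(g, h) \<in> gaps F'"
  shows "(\<exists>J \<in> gaps I. inside J (g, h)) \<or> (\<exists>(g0, h0) \<in> gaps F. inside (g0 + \<delta>, h0) (g, h))"
proof -
  define x where "x = (g + h) / 2"
  have x: "g < x" "x < h"
    using gapsD(1)[OF sep(1) K] by (auto simp: x_def)
  have gh: "g \<in> cov 0 I" "g \<in> cov \<delta> F" "h \<in> cov 0 I" "h \<in> cov \<delta> F"
    using gapsD(2,3)[OF sep(1) K] F' by auto
  have "x \<notin> cov 0 F'"
    using gapsD(4)[OF sep(1) K, of x] x by auto
  then consider "x \<notin> cov 0 I" | "x \<notin> cov \<delta> F"
    using F' by blast
  then show ?thesis
  proof cases
    case 1
    show ?thesis
      by (rule gap_between[OF sep(2) gh(1,3) x 1]) (force simp: inside_def)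
  next
    case 2
    show ?thesis
      by (rule gap_between[OF sep(3) gh(2,4) x 2]) (force simp: inside_def)
  qed
qed

text \<open>The argument of \<open>inside_forward\<close>, with the reach of \<open>B'\<close>
  translated by \<delta>; undoing the translation turns the trace \<open>(g' + \<delta>, h')\<close>
  into \<open>(g', h' - \<delta>)\<close>.\<close>

lemma inside_backward:
  assumes sep: "sep B" "sep F" "sep B'" and B: "\<And>x. x \<in> cov 0 B \<longleftrightarrow> x \<in> cov 0 F \<and> x + \<delta> \<in> cov \<delta> B'"
    and K: "(g, h) \<in> gaps B"
  shows "(\<exists>J \<in> gaps F. inside J (g, h)) \<or> (\<exists>(g', h') \<in> gaps B'. inside (g', h' - \<delta>) (g, h))"
proof -
  define x where "x = (g + h) / 2"
  have x: "g < x" "x < h"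
    using gapsD(1)[OF sep(1) K] by (auto simp: x_def)
  have gh: "g \<in> cov 0 F" "g + \<delta> \<in> cov \<delta> B'" "h \<in> cov 0 F" "h + \<delta> \<in> cov \<delta> B'"
    using gapsD(2,3)[OF sep(1) K] B by auto
  have "x \<notin> cov 0 B"
    using gapsD(4)[OF sep(1) K, of x] x by auto
  then consider "x \<notin> cov 0 F" | "x + \<delta> \<notin> cov \<delta> B'"
    using B by blast
  then show ?thesis
  proof cases
    case 1
    show ?thesis
      by (rule gap_between[OF sep(2) gh(1,3) x 1]) (force simp: inside_def)
  next
    case 2
    have x': "g + \<delta> < x + \<delta>" "x + \<delta> < h + \<delta>"
      using x by auto
    show ?thesis
      by (rule gap_between[OF sep(3) gh(2,4) x' 2]) (force simp: inside_def)
  qed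
qed

lemma controlled_step:
  assumes sep: "sep F'" "sep I" "sep F" "sep B'" "sep B"
    and F': "cov 0 F' = cov 0 I \<inter> cov \<delta> F" and I: "length I \<le> n"
    and B': "controlled F' B' u"
    and B: "\<And>x. x \<in> cov 0 B \<longleftrightarrow> x \<in> cov 0 F \<and> x + \<delta> \<in> cov \<delta> B'"
  shows "controlled F B (u + n)"
proof -
  obtain U where U: "finite U" "card U \<le> u" "\<forall>K \<in> gaps B'. \<exists>J \<in> gaps F' \<union> U. inside J K"
    using B' by (auto simp: controlled_def)
  define V where "V = gaps I \<union> U"
  \<comment> \<open>The gaps of \<open>B'\<close> for which new witnesses are needed. Disjointness
    bounds their number by that of \<open>V\<close>, and their traces form
    \<open>U'\<close>.\<close>
  define W where "W = {K \<in> gaps B'. \<exists>J \<in> V. inside J K}"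
  define U' where "U' = (\<lambda>(g, h). (g, h - \<delta>)) ` W"
  have W: "finite W" "card W \<le> card V"
    using card_gaps_le[OF sep(4), of W V] U(1) by (auto simp: W_def V_def)
  have "card U' \<le> card V"
    using card_image_le[OF W(1)] W(2) unfolding U'_def by (rule le_trans)
  also have "\<dots> \<le> card (gaps I) + card U"
    unfolding V_def by (rule card_Un_le)
  also have "\<dots> \<le> u + n"
    using card_gaps[OF sep(2)] U(2) I by simp
  finally have "card U' \<le> u + n" .
  moreover have "finite U'"
    using W(1) by (simp add: U'_def)
  moreover have "\<exists>J \<in> gaps F \<union> U'. inside J K" if K: "K \<in> gaps B" for K
  proof -
    obtain g h where gh: "K = (g, h)" by force
    from inside_backward[OF sep(5,3,4) B K[unfolded gh]] show ?thesis
    proof (elim disjE bexE)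
      fix J assume "J \<in> gaps F" "inside J (g, h)"
      then show ?thesis
        unfolding gh by blast
    next
      fix K' assume K': "K' \<in> gaps B'" "case K' of (g', h') \<Rightarrow> inside (g', h' - \<delta>) (g, h)"
      obtain g' h' where gh': "K' = (g', h')" by force
      have g'h': "(g', h') \<in> gaps B'" "inside (g', h' - \<delta>) (g, h)"
        using K' by (auto simp: gh')
      show ?thesis
      proof (cases "K' \<in> W")
        case True
        then have "(g', h' - \<delta>) \<in> U'"
          by (force simp: U'_def gh')
        then show ?thesis
          using g'h'(2) unfolding gh by blast
      next
        case False
        then obtain J where J: "J \<in> gaps F'" "inside J K'"
          using U(3) K'(1) by (auto simp: W_def V_def)
        obtain gJ hJ where gJ: "J = (gJ, hJ)" by force
        \<comment> \<open>Since \<open>K'\<close> is not in \<open>W\<close>, neither it nor the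
          smaller \<open>J\<close> contains a gap of \<open>I\<close>; so \<open>J\<close> must come
          from a gap of \<open>F\<close>.\<close>
        have "\<not> (\<exists>J' \<in> gaps I. inside J' K')"
          using False K'(1) by (auto simp: W_def V_def)
        then have "\<not> (\<exists>J' \<in> gaps I. inside J' (gJ, hJ))"
          using J(2) unfolding gJ inside_def by fastforce
        then obtain g0 h0 where g0: "(g0, h0) \<in> gaps F" "inside (g0 + \<delta>, h0) (gJ, hJ)"
          using inside_forward[OF sep(1,2,3) F' J(1)[unfolded gJ]] by blast
        \<comment> \<open>The gap \<open>(g0, h0)\<close> of \<open>F\<close> meets the trace of
          \<open>K'\<close>, and hence also \<open>(g, h)\<close>.\<close>
        have "g' < h0" "g0 < h' - \<delta>" "g0 < h0"
          using g0(2) J(2) g'h'(2) gapsD(1)[OF sep(3) g0(1)] unfolding gJ gh' inside_def by auto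
        then have meet: "g < h0" "g0 < h"
          using g'h'(2) by (auto simp: inside_def)
        have "g \<in> cov 0 F" "h \<in> cov 0 F"
          using gapsD(2,3)[OF sep(5) K[unfolded gh]] B by auto
        \<comment> \<open>The points \<open>g\<close> and \<open>h\<close> belong to
          \<open>F\<close> and cannot lie strictly inside its gap, so meeting becomes
          containment.\<close>
        then have "inside (g0, h0) (g, h)"
          using gapsD(4)[OF sep(3) g0(1), of g] gapsD(4)[OF sep(3) g0(1), of h]
            meet \<open>g0 < h0\<close> by (auto simp: inside_def)
        then show ?thesis
          using g0(1) unfolding gh by blast
      qed
    qed
  qed
  moreover have "cov 0 B \<subseteq> cov 0 F"
    using B by blast
  ultimately show ?thesis
    unfolding controlled_def by blast
qed

section \<open>Interval computation\<close>

fun pairs :: "real list \<Rightarrow> interval list" where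
  "pairs (e # s # ev) = (s, e) # pairs ev"
| "pairs _ = []"

lemma result_pair_up: "result (pair_up ev Is) = rev (pairs ev) @ Is"
  by (induction ev Is rule: pair_up.induct) simp_all

lemma length_pairs: "2 * length (pairs ev) \<le> length ev"
  by (induction ev rule: pairs.induct) simp_all

lemma steps_pair_up: "steps (pair_up ev Is) \<le> length ev + 1"
  by (induction ev Is rule: pair_up.induct) simp_all

text \<open>Loop invariant of \<open>traverse\<close>: even length lets the stack be read as
  complete intervals, and the bound \<open>T\<close> puts the events of the next edge after all
  earlier ones.\<close>

definition events :: "real \<Rightarrow> real list \<Rightarrow> bool" where
  "events T ev \<longleftrightarrow> sep (rev (pairs ev)) \<and> even (length ev) \<and> (\<forall>x \<in> set ev. x \<le> T)"

lemma clip_unit: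
  assumes "result (clip r p u v) = Some (lo, hi)"
  shows "0 \<le> lo \<and> lo \<le> hi \<and> hi \<le> 1"
  using assms by (cases p; cases u; cases v) (auto split: if_splits)

lemma steps_clip: "steps (clip r p u v) \<le> 29"
  by (cases p; cases u; cases v) simp

lemma events_cases:
  assumes "events T ev"
  obtains "ev = []" | e s ev' where "ev = e # s # ev'"
  using assms by (cases ev rule: pairs.cases) (auto simp: events_def)

text \<open>The latest event is at most \<open>T\<close>, hence at most \<open>x\<close>; being
  different from \<open>x\<close>, it is strictly smaller, as separation demands. Equality is the
  case of \<open>events_extend\<close>.\<close>

lemma events_push:
  assumes ev: "events T ev" and "T \<le> x" "x \<le> y" "ev \<noteq> [] \<Longrightarrow> hd ev \<noteq> x"
  shows "events y (y # x # ev)"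
proof -
  have "snd I < x" if "I \<in> set (pairs ev)" for I
  proof (cases rule: events_cases[OF ev])
    case (2 e s ev')
    have "e < x" "s \<le> e" "\<forall>I \<in> set (pairs ev'). snd I < s"
      using assms by (auto simp: 2 events_def sep_append sep_Cons)
    then show ?thesis
      using that by (auto simp: 2)
  qed (use that in simp)
  then show ?thesis
    using assms by (auto simp: events_def sep_append sep_Cons)
qed

lemma events_extend:
  assumes "events T (x # ev)" "T \<le> y"
  shows "events y (y # ev)"
proof (cases rule: events_cases[OF assms(1)])
  case (2 e s ev')
  have "s \<le> e" "e \<le> T"
    using assms(1) by (auto simp: 2 events_def sep_append sep_Cons)
  then show ?thesis
    using assms 2 by (auto simp: events_def sep_append sep_Cons)
qed simp

lemma events_mono: "events T ev \<Longrightarrow> T \<le> T' \<Longrightarrow> events T' ev"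
  by (auto simp: events_def)

lemma add_events:
  assumes ev: "events T ev" and "0 < c" and q: "\<And>lo hi. q = Some (lo, hi) \<Longrightarrow> 0 \<le> lo \<and> lo \<le> hi \<and> hi \<le> 1"
  shows "events (T + c) (result (add_events T c q ev))
    \<and> length (result (add_events T c q ev)) \<le> length ev + 2
    \<and> steps (add_events T c q ev) \<le> 7"
proof (cases q)
  case None
  then show ?thesis
    using events_mono[OF ev] \<open>0 < c\<close> by simp
next
  case (Some lh)
  obtain lo hi where lh: "lh = (lo, hi)" by force
  define x y where "x = T + lo * c" and "y = T + hi * c"
  have bounds: "0 \<le> lo" "lo \<le> hi" "hi \<le> 1"
    using q Some lh by auto
  then have xy: "T \<le> x" "x \<le> y" "y \<le> T + c"
    using \<open>0 < c\<close> mult_right_mono[OF bounds(2), of c] mult_right_mono[OF bounds(3), of c]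
    by (auto simp: x_def y_def)
  show ?thesis
  proof (cases "ev \<noteq> [] \<and> hd ev = x")
    case True
    then obtain ev' where ev': "ev = x # ev'"
      by (cases ev) auto
    have "x \<le> T"
      using ev by (simp add: ev' events_def)
    then have "events (T + c) (y # ev')"
      using events_extend[of T x ev' y] events_mono[OF _ xy(3)] ev xy by (simp add: ev')
    then show ?thesis
      by (simp add: Some lh ev' x_def[symmetric] y_def[symmetric])
  next
    case False
    then have "events (T + c) (y # x # ev)"
      using events_push[OF ev xy(1,2)] events_mono[OF _ xy(3)] by blast
    then show ?thesis
      using False by (cases ev) (auto simp: Some lh x_def[symmetric] y_def[symmetric])
  qed
qed

lemma traverse:
  assumes "events T ev" "\<forall>c \<in> set cs. 0 < c"
  shows "(\<exists>T'. events T' (result (traverse r p T u vs cs ev)))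
    \<and> length (result (traverse r p T u vs cs ev)) \<le> length ev + 2 * length vs
    \<and> steps (traverse r p T u vs cs ev) \<le> 37 * length vs + 1"
  using assms
proof (induction vs arbitrary: T u cs ev)
  case (Cons v vs)
  show ?case
  proof (cases cs)
    case (Cons c cs')
    let ?q = "clip r p u v"
    let ?ev = "add_events T c (result ?q) ev"
    have ev: "events (T + c) (result ?ev)" "length (result ?ev) \<le> length ev + 2" "steps ?ev \<le> 7"
      using add_events[OF Cons.prems(1), of c "result ?q"] clip_unit[of r p u v] Cons.prems(2)
      by (auto simp: Cons)
    show ?thesis
      using Cons.IH[OF ev(1), of cs' v] ev(2,3) Cons.prems(2) steps_clip[of r p u v] by (auto simp: Cons)
  qed (use Cons.prems in auto)
qed auto

lemma path_intervals:
  assumes "embedded_path ps cs"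
  shows "sep (elems (result (path_intervals r p ps cs)))
    \<and> length (elems (result (path_intervals r p ps cs))) \<le> length ps
    \<and> steps (path_intervals r p ps cs) \<le> 42 * length ps + 20"
proof -
  obtain u us where ps: "ps = u # us"
    using assms by (cases ps) (auto simp: embedded_path_def)
  have cs: "\<forall>c \<in> set cs. 0 < c"
    using assms by (simp add: embedded_path_def)
  define ev where "ev = (if result (in_disk r p u) then [0, 0] else ([] :: real list))"
  have ev: "events 0 ev" "length ev \<le> 2"
    by (auto simp: ev_def events_def sep_Cons)
  define ev' where "ev' = traverse r p 0 u us cs ev"
  \<comment> \<open>Two events for the start node and two for each of the remaining nodes, so at
    most one interval per node.\<close>
  have ev': "sep (rev (pairs (result ev')))" "length (result ev') \<le> 2 * length ps"
    "steps ev' \<le> 37 * length ps + 1"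
    using traverse[OF ev(1) cs, of r p u us] ev(2) by (auto simp: ps ev'_def events_def)
  have disk: "steps (in_disk r p u) = 7"
    by (cases p; cases u) simp
  have "result (path_intervals r p ps cs) = Arr (rev (pairs (result ev')))"
    by (simp add: ps ev'_def ev_def result_pair_up)
  moreover have "steps (path_intervals r p ps cs)
      \<le> 9 + steps ev' + steps (pair_up (result ev') []) + length (pairs (result ev')) + 1"
    by (simp add: ps ev'_def ev_def disk result_pair_up)
  ultimately show ?thesis
    using ev' length_pairs[of "result ev'"] steps_pair_up[of "result ev'" "[]"] by simp
qed

lemma all_intervals:
  assumes path: "embedded_path ps cs"
  shows "(\<forall>Is. result (all_intervals r ps cs ms) = Some Is \<longrightarrow> length Is = length ms
      \<and> (\<forall>(t, I) \<in> set Is. sep (elems I) \<and> length (elems I) \<le> length ps))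
    \<and> steps (all_intervals r ps cs ms) \<le> (42 * length ps + 23) * length ms + 1"
proof (induction ms)
  case (Cons m ms)
  obtain p t where m: "m = (p, t)" by (cases m)
  show ?case
    using Cons.IH path_intervals[OF path, of r p]
    by (auto simp: m split: option.splits)
qed simp

section \<open>The sweeps\<close>

text \<open>The entries are listed latest first, as \<open>forward_sweep\<close> stacks them; \<open>I\<close> is the list computed in phase 1.\<close>

fun chain :: "nat \<Rightarrow> (real \<times> interval arr) list \<Rightarrow> bool" where
  "chain n [] \<longleftrightarrow> True"
| "chain n [(t, F)] \<longleftrightarrow> sep (elems F)"
| "chain n ((t', F') # (t, F) # Fs) \<longleftrightarrow> sep (elems F') \<and> chain n ((t, F) # Fs)
    \<and> (\<exists>I. sep I \<and> length I \<le> n \<and> cov 0 (elems F') = cov 0 I \<inter> cov (t' - t) (elems F))"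

abbreviation short :: "nat \<Rightarrow> (real \<times> interval arr) list \<Rightarrow> bool" where
  "short N Fs \<equiv> \<forall>(t, F) \<in> set Fs. length (elems F) \<le> N"

text \<open>A step lengthens the list by at most \<open>n\<close>, so the last premise reserves
  enough of \<open>N\<close> for all steps to come.\<close>

lemma forward_sweep:
  assumes "\<forall>(t, I) \<in> set rest. sep (elems I) \<and> length (elems I) \<le> n"
    and "chain n ((t, prev) # acc)" "short N ((t, prev) # acc)" "N < 2 ^ T"
    and "length (elems prev) + n * length rest \<le> N"
  shows "(\<forall>Fs. result (forward_sweep t prev rest ((t, prev) # acc)) = Some Fs \<longrightarrow>
        chain n Fs \<and> short N Fs \<and> length Fs = length rest + length acc + 1)
    \<and> steps (forward_sweep t prev rest ((t, prev) # acc)) \<le> ((6 * T + 36) * N + 14) * length rest + 1"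
  using assms
proof (induction rest arbitrary: t prev acc)
  case (Cons entry rest)
  obtain t' cur where entry: "entry = (t', cur)" by force
  let ?S = "step_fwd (t' - t) prev cur"
  let ?L = "elems prev" and ?C = "elems cur"
  have sep: "sep ?L" "sep ?C" and len: "length ?C \<le> n"
    using Cons.prems(1,2) by (cases acc; auto simp: entry)+
  have prev: "length ?L < 2 ^ T"
    using Cons.prems(3,4) by auto
  note S = step_spec[OF sep, of "t' - t"] step_fwd[OF sep prev, of "t' - t"]
  have sum: "length ?C + length ?L + n * length rest \<le> N"
    using Cons.prems(5) len by simp
  have "(6 * T + 36) * (length ?C + length ?L) \<le> (6 * T + 36) * N"
    using sum by (intro mult_left_mono) auto
  then have steps: "steps ?S \<le> (6 * T + 36) * N + 10"
    using S(5) by linarith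
  have "chain n ((t', result ?S) # (t, prev) # acc)"
    using S(1,2,4) sep(2) len Cons.prems(2) by auto
  moreover have "short N ((t', result ?S) # (t, prev) # acc)"
    using S(3,4) sum Cons.prems(3) by auto
  moreover have "length (elems (result ?S)) + n * length rest \<le> N"
    using S(3,4) sum by simp
  ultimately have IH: "(\<forall>Fs. result (forward_sweep t' (result ?S) rest ((t', result ?S) # (t, prev) # acc)) = Some Fs \<longrightarrow>
        chain n Fs \<and> short N Fs \<and> length Fs = length rest + length ((t, prev) # acc) + 1)
    \<and> steps (forward_sweep t' (result ?S) rest ((t', result ?S) # (t, prev) # acc))
      \<le> ((6 * T + 36) * N + 14) * length rest + 1"
    using Cons.prems(1) by (intro Cons.IH Cons.prems(4)) auto
  show ?case
    using IH steps by (simp add: entry)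
qed simp

text \<open>\<open>F\<close> is the forward list from which \<open>nxt\<close> arose. The witness
  number \<open>u\<close> grows by at most \<open>n\<close> per step and stays within
  \<open>N\<close>; with at most \<open>N\<close> intervals in the forward list this gives
  \<open>2 * N + 1\<close>, and \<open>3 * N + 1\<close> for the two lists entering a step.\<close>

lemma backward_sweep:
  assumes "chain n ((t, F) # rest)" "short N rest" "sep (elems nxt)"
    and "controlled (elems F) (elems nxt) u" "u + n * length rest \<le> N"
    and "short (2 * N + 1) acc" "length (elems nxt) \<le> 2 * N + 1" "2 * N + 1 < 2 ^ T"
  shows "(\<forall>Bs. result (backward_sweep t nxt rest acc) = Some Bs \<longrightarrow>
        short (2 * N + 1) Bs \<and> length Bs = length rest + length acc)
    \<and> steps (backward_sweep t nxt rest acc) \<le> ((6 * T + 40) * (3 * N + 1) + 14) * length rest + 1"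
  using assms
proof (induction rest arbitrary: t F nxt u acc)
  case (Cons entry rest)
  obtain t' cur where entry: "entry = (t', cur)" by force
  let ?S = "step_bwd (t - t') nxt cur"
  let ?L = "elems nxt" and ?C = "elems cur"
  obtain I where I: "sep I" "length I \<le> n" "cov 0 (elems F) = cov 0 I \<inter> cov (t - t') ?C"
    and sepF: "sep (elems F)" and chain: "chain n ((t', cur) # rest)"
    using Cons.prems(1) by (auto simp: entry)
  have sepC: "sep ?C"
    using chain by (cases rest) auto
  have nxt: "length ?L < 2 ^ T"
    using Cons.prems(7,8) by simp
  have len: "length ?C \<le> N"
    using Cons.prems(2) by (simp add: entry)
  note S = step_spec[of "mir ?L" "mir ?C" "t - t'"] step_bwd[OF Cons.prems(3) sepC nxt, of "t - t'"]
  have sepS: "sep (elems (result ?S))"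
    using S(1,4) Cons.prems(3) sepC by simp
  \<comment> \<open>Reflections cancel on \<open>cur\<close> and leave on \<open>nxt\<close> the
    shift by the time difference.\<close>
  have "x \<in> cov 0 (elems (result ?S)) \<longleftrightarrow> x \<in> cov 0 ?C \<and> x + (t - t') \<in> cov (t - t') ?L" for x
    using S(2) Cons.prems(3) sepC by (simp add: S(4) cov_mir add.commute)
  then have controlled: "controlled ?C (elems (result ?S)) (u + n)"
    using controlled_step[OF sepF I(1) sepC Cons.prems(3) sepS I(3,2) Cons.prems(4)] by blast
  have un: "u + n + n * length rest \<le> N"
    using Cons.prems(5) by simp
  have lenS: "length (elems (result ?S)) \<le> 2 * N + 1"
    using length_controlled[OF controlled sepC sepS] un len by simp
  have "(6 * T + 40) * (length ?C + length ?L) \<le> (6 * T + 40) * (3 * N + 1)"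
    using len Cons.prems(7) by (intro mult_left_mono) auto
  then have steps: "steps ?S \<le> (6 * T + 40) * (3 * N + 1) + 10"
    using S(5) by linarith
  have IH: "(\<forall>Bs. result (backward_sweep t' (result ?S) rest ((t', result ?S) # acc)) = Some Bs \<longrightarrow>
        short (2 * N + 1) Bs \<and> length Bs = length rest + length ((t', result ?S) # acc))
    \<and> steps (backward_sweep t' (result ?S) rest ((t', result ?S) # acc))
      \<le> ((6 * T + 40) * (3 * N + 1) + 14) * length rest + 1"
    using Cons.prems(2,6) lenS
    by (intro Cons.IH[OF chain _ sepS controlled un _ lenS Cons.prems(8)]) auto
  show ?case
    using IH steps by (simp add: entry)
qed simp

section \<open>Extraction and the sum over all phases\<close>

lemma steps_extraction:
  assumes "short M rest" "M < 2 ^ T"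
  shows "steps (extraction t l rest acc) \<le> (6 * T + 12) * length rest + length acc + 1"
  using assms(1)
proof (induction rest arbitrary: t l acc)
  case (Cons entry rest)
  obtain t' I where entry: "entry = (t', I)" by force
  let ?P = "\<lambda>j. aget I j \<bind> (\<lambda>p. tick (l + (t' - t) < fst p))"
  have "steps (bsearch ?P 0 (length (elems I))) \<le> 6 * T + 1"
    using steps_bsearch[of ?P 2 "length (elems I)" 0 T] Cons.prems assms(2) by (simp add: entry)
  moreover define m where "m = result (bsearch ?P 0 (length (elems I)))"
  moreover define l' where "l' = min (l + (t' - t)) (snd (elems I ! (m - 1)))"
  moreover have "steps (extraction t' l' rest (l' # acc)) \<le> (6 * T + 12) * length rest + length acc + 2"
    using Cons.IH[of t' l' "l' # acc"] Cons.prems by simp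
  ultimately show ?case
    by (simp add: entry split_def)
qed simp

lemma steps_if_some:
  assumes "steps m \<le> a" "\<And>y. result m = Some y \<Longrightarrow> steps (f y) \<le> b"
  shows "steps (if_some m f) \<le> a + b"
  using assms by (cases "result m") (auto simp: if_some_def intro: add_mono)

lemma start_forward:
  assumes "\<forall>(t, I) \<in> set Is. sep (elems I) \<and> length (elems I) \<le> n"
    and "n * length Is \<le> N" "N < 2 ^ T"
  shows "(\<forall>Fs. result (start_forward Is) = Some Fs \<longrightarrow>
        chain n Fs \<and> short N Fs \<and> length Fs = length Is)
    \<and> steps (start_forward Is) \<le> ((6 * T + 36) * N + 14) * length Is + 2"
proof (cases Is)
  case (Cons entry rest)
  obtain t I where entry: "entry = (t, I)" by force
  show ?thesis
    using forward_sweep[of rest n t I "[]" N T] assms by (auto simp: start_forward_def Cons entry)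
qed (simp add: start_forward_def)

lemma start_backward:
  assumes "chain n Fs" "short N Fs" "n * length Fs \<le> N" "2 * N + 1 < 2 ^ T"
  shows "(\<forall>Bs. result (start_backward Fs) = Some Bs \<longrightarrow>
        short (2 * N + 1) Bs \<and> length Bs = length Fs)
    \<and> steps (start_backward Fs) \<le> ((6 * T + 40) * (3 * N + 1) + 14) * length Fs + 2"
proof (cases Fs)
  case (Cons entry rest)
  obtain t F where entry: "entry = (t, F)" by force
  have sep: "sep (elems F)"
    using assms(1) by (cases rest) (auto simp: Cons entry)
  show ?thesis
    using backward_sweep[of n t F rest N F 0 "[(t, F)]" T] assms sep controlled_refl[OF sep]
    by (auto simp: start_backward_def Cons entry)
qed (simp add: start_backward_def)

lemma steps_start_extraction:
  assumes "short M Bs" "M < 2 ^ T"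
  shows "steps (start_extraction Bs) \<le> (6 * T + 12) * length Bs + 6"
proof (cases Bs)
  case (Cons entry rest)
  obtain t I where entry: "entry = (t, I)" by force
  show ?thesis
    using steps_extraction[of rest M T t "snd (elems I ! (length (elems I) - 1))"
        "[snd (elems I ! (length (elems I) - 1))]"] assms
    by (simp add: start_extraction_def Cons entry split_def)
qed (simp add: start_extraction_def)

lemma comma_time_le:
  assumes path: "embedded_path ps cs" and N: "N = length ps * length ms" "0 < N" and T: "2 * N + 1 < 2 ^ T"
  shows "comma_time r ps cs ms \<le> 400 * (T * length ms * N)"
proof -
  let ?n = "length ps" and ?k = "length ms"
  let ?a = "(42 * ?n + 23) * ?k + 1"
  let ?f = "((6 * T + 36) * N + 14) * ?k + 2"
  let ?b = "((6 * T + 40) * (3 * N + 1) + 14) * ?k + 2"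
  let ?e = "(6 * T + 12) * ?k + 6"
  have "N < 2 ^ T"
    using T by linarith
  have "steps (comma r ps cs ms) \<le> ?a + (?f + (?b + ?e))"
    unfolding comma_def
  proof (intro steps_if_some)
    note A = all_intervals[OF path, of r ms]
    then show "steps (all_intervals r ps cs ms) \<le> ?a"
      by blast
    fix Is assume Is: "result (all_intervals r ps cs ms) = Some Is"
    have F: "(\<forall>Fs. result (start_forward Is) = Some Fs \<longrightarrow> chain ?n Fs \<and> short N Fs \<and> length Fs = ?k)
      \<and> steps (start_forward Is) \<le> ?f"
      using start_forward[of Is ?n N T] A Is N \<open>N < 2 ^ T\<close> by auto
    then show "steps (start_forward Is) \<le> ?f"
      by blast
    fix Fs assume Fs: "result (start_forward Is) = Some Fs"
    have B: "(\<forall>Bs. result (start_backward Fs) = Some Bs \<longrightarrow> short (2 * N + 1) Bs \<and> length Bs = ?k)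
      \<and> steps (start_backward Fs) \<le> ?b"
      using start_backward[of ?n Fs N T] F Fs N T by auto
    then show "steps (start_backward Fs) \<le> ?b"
      by blast
    fix Bs assume Bs: "result (start_backward Fs) = Some Bs"
    then show "steps (start_extraction Bs) \<le> ?e"
      using steps_start_extraction[of Bs "2 * N + 1" T] B T by auto
  qed
  also have "\<dots> \<le> 400 * (T * ?k * N)"
  proof -
    have "T \<noteq> 0"
      using T by (intro notI) simp
    then have pos: "1 \<le> ?k" "1 \<le> T" "1 \<le> N"
      using N by (auto simp: Suc_le_eq)
    define P where "P = T * ?k * N"
    have P: "N \<le> P" "?k \<le> P" "T * ?k \<le> P" "?k * N \<le> P" "1 \<le> P"
      using pos by (auto simp: P_def)
    \<comment> \<open>Every monomial on the right is at most \<open>P\<close>, and the coefficients,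
      constant included, add up to 348.\<close>
    have "?a + (?f + (?b + ?e))
        = 42 * N + 103 * ?k + 24 * P + 156 * (?k * N) + 12 * (T * ?k) + 11"
      using N(1) P by (simp add: P_def algebra_simps)
    then show ?thesis
      using P unfolding P_def[symmetric] by linarith
  qed
  finally show ?thesis
    by (simp add: comma_time_def)
qed

section \<open>From the binary exponent to the logarithm\<close>

theorem lemma3:
  shows "\<exists>C :: real. \<forall>(n :: nat) (k :: nat) (r :: real) (ps :: point list) (cs :: real list)
           (ms :: measurement list).
           embedded_path ps cs \<and> length ps = n \<and> length ms = k \<and> 0 \<le> r \<and> 2 \<le> n * k
           \<longrightarrow> real (comma_time r ps cs ms)
                 \<le> C * (real k ^ 2 * real n * ln (real n * real k))"
proof (intro exI[of _ "1600 / ln 2"] allI impI)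
  fix n k :: nat and r :: real and ps :: "point list" and cs :: "real list" and ms :: "measurement list"
  assume A: "embedded_path ps cs \<and> length ps = n \<and> length ms = k \<and> 0 \<le> r \<and> 2 \<le> n * k"
  define N where "N = n * k"
  have N: "2 \<le> N"
    using A by (simp add: N_def)
  \<comment> \<open>\<open>T\<close> is the least exponent with \<open>2 * N + 1 < 2 ^ T\<close>. It
    will turn out to be at most \<open>4 * ln N / ln 2\<close>, and multiplying the 400 of
    \<open>comma_time_le\<close> by this 4 gives 1600.\<close>
  obtain T' where T': "2 ^ T' \<le> 2 * N + 1" "2 * N + 1 < 2 ^ (T' + 1)"
    using ex_power_ivl1[of 2 "2 * N + 1"] by auto
  define T where "T = T' + 1"
  have "embedded_path ps cs" "N = length ps * length ms" "0 < N" "2 * N + 1 < 2 ^ T"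
    using A N T'(2) by (auto simp: N_def T_def intro: gr0I)
  from comma_time_le[OF this] have "comma_time r ps cs ms \<le> 400 * (T * k * N)"
    using A by blast
  then have time: "real (comma_time r ps cs ms) \<le> 400 * (real T * real k * real N)"
    by (metis (mono_tags) of_nat_le_iff of_nat_mult of_nat_numeral)
  \<comment> \<open>Minimality gives \<open>2 ^ T \<le> 4 * N + 2\<close>; then 8 is at most
    \<open>N ^ 3\<close> because \<open>N\<close> is at least 2, which also absorbs the constant
    into the logarithm.\<close>
  have "2 ^ T \<le> 8 * N"
    using T'(1) N by (simp add: T_def)
  also have "\<dots> \<le> N ^ 4"
    using mult_right_mono[OF power_mono[OF N, of 3], of N] power_Suc2[of N 3] by simp
  finally have "(2 :: real) ^ T \<le> real N ^ 4"
    by (metis of_nat_le_iff of_nat_numeral of_nat_power)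
  then have "ln ((2 :: real) ^ T) \<le> ln (real N ^ 4)"
    using N by (subst ln_le_cancel_iff) auto
  then have "real T * ln 2 \<le> 4 * ln (real N)"
    using N by (simp add: ln_realpow)
  then have "real T \<le> 4 * ln (real N) / ln 2"
    by (simp add: pos_le_divide_eq)
  then have "400 * (real T * real k * real N) \<le> 400 * (4 * ln (real N) / ln 2 * real k * real N)"
    by (intro mult_left_mono mult_right_mono) auto
  also have "\<dots> = 1600 / ln 2 * (real k ^ 2 * real n * ln (real n * real k))"
    by (simp add: N_def power2_eq_square)
  finally show "real (comma_time r ps cs ms)
      \<le> 1600 / ln 2 * (real k ^ 2 * real n * ln (real n * real k))"
    using time by linarith
qed

end
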